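(* Let $K\ge 1$ be an integer and let $\mathbf r=(r_{1,s},\ldots,r_{K,s})$ be the ordered distances from the typical user (at the origin) to the $K$ closest small base stations (the cooperative SBS cluster). The probability $\mathcal A_{\mathrm{SBS_{cl}}}$ that the typical user is associated with the SBS cluster is $$\mathcal A_{\mathrm{SBS_{cl}}}=\int_{0<r_{1,s}<r_{2,s}<\cdots<r_{K,s}<\infty} e^{-\lambda_m\pi\,\eta^{2/\alpha}}\,f_\Lambda(\mathbf r)\,d\mathbf r,\qquad \eta=\eta(\mathbf r)=\frac{1}{\hat p_s\hat\Delta_s\hat B_s\sum_{i=1}^K r_{i,s}^{-\alpha}},$$ where $f_\Lambda$ is the joint probability density function of $(r_{1,s},\ldots,r_{K,s})$.
   Context: Macro base stations (MBSs) and small base stations (SBSs) form independent homogeneous Poisson point processes $\Phi_m,\Phi_s$ on $\mathbb R^2$ with densities $\lambda_m,\lambda_s>0$. For $j\in\{m,s\}$ let $p_j>0$ be the transmit power, $M_j\ge\Psi_j\ge1$ integers (number of antennas and number of served users), $\Delta_j=M_j-\Psi_j+1$, and $B_j>0$ the bias. Both tiers have the same path-loss exponent $\alpha>2$. Put $\hat p_s=p_s/p_m$, $\hat\Delta_s=\Delta_s/\Delta_m$, $\hat B_s=B_s/B_m$. The average received power from a tier-$j$ base station at distance $r$ is $p_j\Delta_j r^{-\alpha}$. Let $r_m$ be the distance from the origin to the nearest MBS. The typical user is associated with the SBS cluster if $\sum_{i=1}^K B_s p_s\Delta_s r_{i,s}^{-\alpha}>B_m p_m\Delta_m r_m^{-\alpha}$,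 and with the nearest MBS otherwise. Explicitly, $f_\Lambda(\mathbf r)=(2\pi\lambda_s)^K e^{-\lambda_s\pi r_{K,s}^2}\prod_{i=1}^K r_{i,s}$ on $0<r_{1,s}<\cdots<r_{K,s}$ and $0$ elsewhere. *)

theory Defs
  imports "HOL-Probability.Probability"
begin

definition locally_finite_set :: "'a::euclidean_space set \<Rightarrow> bool" where
  "locally_finite_set S \<longleftrightarrow> (\<forall>B. bounded B \<longrightarrow> finite (S \<inter> B))"

definition conf_space :: "'a::euclidean_space set measure" where
  "conf_space = sigma {S. locally_finite_set S}
     {{S. locally_finite_set S \<and> card (S \<inter> B) = n} | B n. B \<in> sets borel \<and> bounded B}"

(* The count distribution is spelled out, since poisson_pmf is only specified for a positive
   rate; for null sets B the formula below gives count 0 almost surely (as 0 ^ 0 = 1). *)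
definition homogeneous_ppp ::
  "'w measure \<Rightarrow> real \<Rightarrow> ('w \<Rightarrow> 'a::euclidean_space set) \<Rightarrow> bool" where
  "homogeneous_ppp P lam \<Phi> \<longleftrightarrow>
     \<Phi> \<in> measurable P conf_space \<and>
     (\<forall>B n. B \<in> sets borel \<longrightarrow> bounded B \<longrightarrow>
        measure P {\<omega> \<in> space P. card (\<Phi> \<omega> \<inter> B) = n} =
          exp (- (lam * measure lborel B)) * (lam * measure lborel B) ^ n / fact n) \<and>
     (\<forall>N (B :: nat \<Rightarrow> 'a set).
        (\<forall>i<N. B i \<in> sets borel \<and> bounded (B i)) \<longrightarrow> disjoint_family_on B {..<N} \<longrightarrow>
        prob_space.indep_vars P (\<lambda>_. count_space UNIV) (\<lambda>i \<omega>. card (\<Phi> \<omega> \<inter> B i)) {..<N})"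

(* For 1 \<le> i: the i-th entry in the nondecreasing list of the norms of the points of S,
   that is, the least radius of a closed ball around the origin with at least i points.
   Unspecified if S has fewer than i points. *)
definition nth_nearest_dist :: "nat \<Rightarrow> 'a::euclidean_space set \<Rightarrow> real" where
  "nth_nearest_dist i S = Inf {r. i \<le> card (S \<inter> cball 0 r)}"

lemma nth_nearest_dist_le_iff:
  assumes S: "locally_finite_set S" and i: "1 \<le> i" and ex: "\<exists>R. i \<le> card (S \<inter> cball 0 R)"
  shows "nth_nearest_dist i S \<le> r \<longleftrightarrow> i \<le> card (S \<inter> cball 0 r)"
proof -
  define T where "T = {r. i \<le> card (S \<inter> cball 0 r)}"
  have fin: "finite (S \<inter> cball 0 t)" for t
    using S by (auto simp: locally_finite_set_def)
  have "0 \<le> t" if "t \<in> T" for t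
  proof (rule ccontr)
    assume "\<not> 0 \<le> t"
    then have "S \<inter> cball 0 t = {}" by simp
    with that i show False by (simp add: T_def)
  qed
  then have bdd: "bdd_below T" by (rule bdd_belowI)
  have ne: "T \<noteq> {}" using ex by (auto simp: T_def)
  have "r < Inf T" if "r \<notin> T"
  proof -
    define D where "D = insert (r + 1) (norm ` (S \<inter> cball 0 (r + 1)) \<inter> {r<..})"
    have D: "finite D" "D \<noteq> {}" using fin by (auto simp: D_def)
    have "r < Min D" using D by (auto simp: D_def)
    moreover have "Min D \<le> t" if "t \<in> T" for t
    proof (rule ccontr)
      assume *: "\<not> Min D \<le> t"
      have "S \<inter> cball 0 t \<subseteq> S \<inter> cball 0 r"
      proof (rule subsetI, rule ccontr)
        fix x assume x: "x \<in> S \<inter> cball 0 t" "x \<notin> S \<inter> cball 0 r"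
        have "Min D \<le> r + 1" using D by (auto simp: D_def)
        with x * have "norm x \<in> D" by (auto simp: D_def)
        then have "Min D \<le> norm x" using D by simp
        with x * show False by auto
      qed
      then have "card (S \<inter> cball 0 t) \<le> card (S \<inter> cball 0 r)"
        by (intro card_mono fin)
      with \<open>t \<in> T\<close> \<open>r \<notin> T\<close> show False by (simp add: T_def)
    qed
    then have "Min D \<le> Inf T" using ne by (intro cInf_greatest) auto
    ultimately show ?thesis by simp
  qed
  moreover have "Inf T \<le> r" if "r \<in> T"
    using that bdd by (rule cInf_lower)
  ultimately show ?thesis
    unfolding nth_nearest_dist_def T_def[symmetric] by (force simp: T_def)
qed

definition spatial_gain :: "nat \<Rightarrow> nat \<Rightarrow> real" where
  "spatial_gain M \<Psi> = real M - real \<Psi> + 1"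

definition avg_received_power :: "real \<Rightarrow> real \<Rightarrow> real \<Rightarrow> real \<Rightarrow> real" where
  "avg_received_power p D \<alpha> r = p * D * r powr (- \<alpha>)"

definition cluster_dists ::
  "nat \<Rightarrow> ('w \<Rightarrow> 'a::euclidean_space set) \<Rightarrow> 'w \<Rightarrow> nat \<Rightarrow> real" where
  "cluster_dists K \<Phi> \<omega> = (\<lambda>i\<in>{1..K}. nth_nearest_dist i (\<Phi> \<omega>))"

definition cluster_association_event ::
  "'w measure \<Rightarrow> nat \<Rightarrow> real \<Rightarrow> real \<Rightarrow> real \<Rightarrow> real \<Rightarrow> real \<Rightarrow> real \<Rightarrow> real \<Rightarrow>
     ('w \<Rightarrow> 'a::euclidean_space set) \<Rightarrow> ('w \<Rightarrow> 'a set) \<Rightarrow> 'w set" where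
  "cluster_association_event P K \<alpha> Bm pm Dm Bs ps Ds \<Phi>m \<Phi>s =
     {\<omega> \<in> space P. (\<Sum>i=1..K. Bs * avg_received_power ps Ds \<alpha> (cluster_dists K \<Phi>s \<omega> i))
        > Bm * avg_received_power pm Dm \<alpha> (infdist 0 (\<Phi>m \<omega>))}"

definition ordered_region :: "nat \<Rightarrow> (nat \<Rightarrow> real) set" where
  "ordered_region K = {r \<in> {1..K} \<rightarrow>\<^sub>E UNIV. 0 < r 1 \<and> (\<forall>i\<in>{1..<K}. r i < r (Suc i))}"

definition f_Lambda :: "real \<Rightarrow> nat \<Rightarrow> (nat \<Rightarrow> real) \<Rightarrow> real" where
  "f_Lambda lam_s K r =
     (if r \<in> ordered_region K
      then (2 * pi * lam_s) ^ K * exp (- lam_s * pi * (r K)\<^sup>2) * (\<Prod>i=1..K. r i) else 0)"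

definition eta :: "real \<Rightarrow> real \<Rightarrow> real \<Rightarrow> real \<Rightarrow> nat \<Rightarrow> (nat \<Rightarrow> real) \<Rightarrow> real" where
  "eta p_hat D_hat B_hat \<alpha> K r = 1 / (p_hat * D_hat * B_hat * (\<Sum>i=1..K. r i powr (- \<alpha>)))"

end

theory Submission
  imports Defs
begin

text \<open>A point configuration has its \<open>i\<close>-th nearest points in consecutive disjoint intervals
  \<open>(a\<^sub>i, b\<^sub>i]\<close> with \<open>b\<^sub>i \<le> a\<^sub>i\<^sub>+\<^sub>1\<close> if and only if the annuli cut out by these intervals contain one
  point each (at least one for the last) and the annuli between them none. Independence of the
  counts turns the probability of this event into a product, which is the integral of
  \<open>f_Lambda\<close> over the box. Such boxes form an intersection-stable generator of the ordered region,
  and almost surely no two points have equal norm, so \<open>f_Lambda\<close> is the joint density. The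
  association event says that the nearest point of the other process has distance above
  \<open>\<eta> powr (1 / \<alpha>)\<close>, which by independence and the void probability of a disc has conditional
  probability \<open>exp (- lam_m * pi * \<eta> powr (2 / \<alpha>))\<close>.\<close>

section \<open>Measurability of counts and nearest distances on the configuration space\<close>

lemma space_conf_space: "space conf_space = {S. locally_finite_set S}"
  unfolding conf_space_def by (intro space_measure_of) auto

lemma measurable_card_Int [measurable]:
  fixes B :: "'a::euclidean_space set"
  assumes "B \<in> sets borel" "bounded B"
  shows "(\<lambda>S. card (S \<inter> B)) \<in> measurable conf_space (count_space UNIV)"
  unfolding measurable_count_space_eq2_countable
proof (intro conjI ballI)
  fix n :: nat
  have "{S. locally_finite_set S \<and> card (S \<inter> B) = n} \<in> sets conf_space"
    unfolding conf_space_def using assms by (intro in_measure_of) auto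
  also have "{S. locally_finite_set S \<and> card (S \<inter> B) = n} =
      (\<lambda>S. card (S \<inter> B)) -` {n} \<inter> space conf_space"
    by (auto simp: space_conf_space)
  finally show "(\<lambda>S. card (S \<inter> B)) -` {n} \<inter> space conf_space \<in> sets conf_space" .
qed simp

lemma card_Int_cball_mono:
  assumes "locally_finite_set S" "s \<le> t"
  shows "card (S \<inter> cball 0 s) \<le> card (S \<inter> cball 0 t)"
  using assms by (intro card_mono) (auto simp: locally_finite_set_def)

lemma card_Int_annulus:
  assumes "locally_finite_set S" "s \<le> t"
  shows "card (S \<inter> (cball 0 t - cball 0 s)) = card (S \<inter> cball 0 t) - card (S \<inter> cball 0 s)"
proof -
  have "card (S \<inter> cball 0 t - S \<inter> cball 0 s) = card (S \<inter> cball 0 t) - card (S \<inter> cball 0 s)"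
    using assms by (intro card_Diff_subset) (auto simp: locally_finite_set_def)
  moreover have "S \<inter> (cball 0 t - cball 0 s) = S \<inter> cball 0 t - S \<inter> cball 0 s" by auto
  ultimately show ?thesis by simp
qed

text \<open>Monotonicity of counts in the radius makes the existence over all reals a countable one,
  so that having at least \<open>i\<close> points becomes a measurable condition.\<close>

lemma ex_radius_iff_ex_nat_radius:
  assumes "locally_finite_set S"
  shows "(\<exists>R. i \<le> card (S \<inter> cball 0 R)) \<longleftrightarrow> (\<exists>n::nat. i \<le> card (S \<inter> cball 0 (real n)))"
proof
  assume "\<exists>R. i \<le> card (S \<inter> cball 0 R)"
  then obtain R where R: "i \<le> card (S \<inter> cball 0 R)" by auto
  obtain n :: nat where "R \<le> real n" using real_arch_simple by blast
  from card_Int_cball_mono[OF assms this] R have "i \<le> card (S \<inter> cball 0 (real n))" by simp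
  then show "\<exists>n::nat. i \<le> card (S \<inter> cball 0 (real n))" ..
qed auto

text \<open>Where at least \<open>i\<close> points exist, the sublevel sets are count events.
  Elsewhere the distance is the constant \<open>Inf {}\<close>, unspecified but the same for all
  such configurations, so the two cases can be glued along a measurable condition.\<close>

lemma measurable_nth_nearest_dist:
  assumes "1 \<le> i"
  shows "nth_nearest_dist i \<in> borel_measurable (conf_space :: 'a::euclidean_space set measure)"
proof -
  define m where "m S = (if \<exists>n::nat. i \<le> card (S \<inter> cball 0 (real n)) then
      nth_nearest_dist i S else Inf {})" for S :: "'a set"
  have eq: "m S = nth_nearest_dist i S" if "S \<in> space conf_space" for S
  proof -
    have "{r. i \<le> card (S \<inter> cball 0 r)} = {}" if "\<not> (\<exists>R. i \<le> card (S \<inter> cball 0 R))"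
      using that by auto
    then show ?thesis
      using that ex_radius_iff_ex_nat_radius[of S i]
      by (auto simp: m_def nth_nearest_dist_def space_conf_space)
  qed
  have "m \<in> borel_measurable conf_space"
    unfolding borel_measurable_iff_le
  proof
    fix r
    have "{S \<in> space conf_space. m S \<le> r} = {S \<in> space conf_space.
       ((\<exists>n::nat. i \<le> card (S \<inter> cball 0 (real n))) \<longrightarrow> i \<le> card (S \<inter> cball 0 r)) \<and>
       (\<not> (\<exists>n::nat. i \<le> card (S \<inter> cball 0 (real n))) \<longrightarrow> Inf {} \<le> r)}"
      using ex_radius_iff_ex_nat_radius[of _ i] nth_nearest_dist_le_iff[OF _ assms]
      by (auto simp: m_def space_conf_space)
    also have "\<dots> \<in> sets conf_space" by measurable
    finally show "{S \<in> space conf_space. m S \<le> r} \<in> sets conf_space" .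
  qed
  then show ?thesis by (subst (asm) measurable_cong[OF eq])
qed

text \<open>Local finiteness makes the infimum of the norms attained. The empty set is excluded
  because the conventions differ there: \<open>infdist\<close> is 0, the other side is
  \<open>Inf {}\<close>.\<close>

lemma infdist_eq_nth_nearest_dist:
  fixes S :: "'a::euclidean_space set"
  assumes S: "locally_finite_set S" and "S \<noteq> {}"
  shows "infdist 0 S = nth_nearest_dist 1 S"
proof (rule antisym)
  have iff: "1 \<le> card (S \<inter> cball 0 r) \<longleftrightarrow> (\<exists>x\<in>S. norm x \<le> r)" for r
  proof -
    have "finite (S \<inter> cball 0 r)" using S by (auto simp: locally_finite_set_def)
    then have "1 \<le> card (S \<inter> cball 0 r) \<longleftrightarrow> S \<inter> cball 0 r \<noteq> {}"
      by (metis One_nat_def Suc_leI card_gt_0_iff not_one_le_zero card.empty)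
    then show ?thesis by auto
  qed
  from \<open>S \<noteq> {}\<close> obtain x0 where "x0 \<in> S" by auto
  then have ex: "\<exists>R. 1 \<le> card (S \<inter> cball 0 R)" unfolding iff by auto
  note le_iff = nth_nearest_dist_le_iff[OF S order.refl ex, unfolded iff]
  show "infdist 0 S \<le> nth_nearest_dist 1 S"
    using le_iff[of "nth_nearest_dist 1 S"] infdist_le[of _ S "0::'a"] by (auto intro: order_trans)
  have "nth_nearest_dist 1 S \<le> dist 0 x" if "x \<in> S" for x
    unfolding le_iff using that by auto
  then show "nth_nearest_dist 1 S \<le> infdist 0 S"
    unfolding infdist_def using \<open>S \<noteq> {}\<close> by (auto intro!: cINF_greatest)
qed

text \<open>Converts a tail event of the nearest distance into a void event, whose probability the
  count law gives. For the empty set \<open>infdist\<close> is 0, and the equivalence fails for t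
  \<ge> 0.\<close>

lemma less_infdist_iff:
  fixes S :: "'a::euclidean_space set"
  assumes S: "locally_finite_set S" and "S \<noteq> {}"
  shows "t < infdist 0 S \<longleftrightarrow> card (S \<inter> cball 0 t) = 0"
proof -
  from \<open>S \<noteq> {}\<close> obtain x0 where "x0 \<in> S" by auto
  moreover have "finite (S \<inter> cball 0 (norm x0))" using S by (auto simp: locally_finite_set_def)
  ultimately have "1 \<le> card (S \<inter> cball 0 (norm x0))"
    by (metis One_nat_def Suc_leI card_gt_0_iff IntI empty_iff mem_cball_0 order.refl)
  then have "infdist 0 S \<le> t \<longleftrightarrow> 1 \<le> card (S \<inter> cball 0 t)"
    unfolding infdist_eq_nth_nearest_dist[OF assms]
    by (intro nth_nearest_dist_le_iff S) auto
  then show ?thesis by linarith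
qed

lemma measurable_infdist_conf_space:
  "infdist 0 \<in> borel_measurable (conf_space :: 'a::euclidean_space set measure)"
proof -
  \<comment> \<open>The default 0 is the value of \<open>infdist\<close> at the empty set.\<close>
  define m where "m S = (if \<exists>n::nat. 1 \<le> card (S \<inter> cball 0 (real n)) then
      nth_nearest_dist 1 S else 0)" for S :: "'a set"
  have [measurable]: "nth_nearest_dist 1 \<in> borel_measurable (conf_space :: 'a set measure)"
    by (rule measurable_nth_nearest_dist) simp
  have "m \<in> borel_measurable conf_space" unfolding m_def by measurable
  moreover have "m S = infdist 0 S" if "S \<in> space conf_space" for S
  proof (cases "S = {}")
    case False
    then obtain x0 where x0: "x0 \<in> S" by auto
    have lf: "locally_finite_set S" using that by (simp add: space_conf_space)
    then have "finite (S \<inter> cball 0 (norm x0))" by (auto simp: locally_finite_set_def)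
    with x0 have "1 \<le> card (S \<inter> cball 0 (norm x0))"
      by (metis One_nat_def Suc_leI card_gt_0_iff IntI empty_iff mem_cball_0 order.refl)
    then have "\<exists>n::nat. 1 \<le> card (S \<inter> cball 0 (real n))"
      using ex_radius_iff_ex_nat_radius[OF lf, of 1] by blast
    then show ?thesis using infdist_eq_nth_nearest_dist[OF lf False] by (simp add: m_def)
  qed (simp add: m_def infdist_def)
  ultimately show ?thesis by (subst (asm) measurable_cong)
qed

section \<open>Almost sure properties of a single Poisson process\<close>

abbreviation vol :: "'a::euclidean_space set \<Rightarrow> real" where
  "vol \<equiv> measure lborel"

locale poisson_process = prob_space P for P :: "'w measure" +
  fixes lam :: real and \<Phi> :: "'w \<Rightarrow> 'a::euclidean_space set"
  assumes lam_pos: "0 < lam" and ppp: "homogeneous_ppp P lam \<Phi>"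
begin

abbreviation N :: "'w \<Rightarrow> real \<Rightarrow> nat" where
  "N \<omega> t \<equiv> card (\<Phi> \<omega> \<inter> cball 0 t)"

lemma measurable_Phi [measurable]: "\<Phi> \<in> measurable P conf_space"
  using ppp by (simp add: homogeneous_ppp_def)

lemma locally_finite_Phi: "\<omega> \<in> space P \<Longrightarrow> locally_finite_set (\<Phi> \<omega>)"
  using measurable_space[OF measurable_Phi] by (simp add: space_conf_space)

lemma measurable_count [measurable]:
  fixes B :: "'a set"
  assumes "B \<in> sets borel" "bounded B"
  shows "(\<lambda>\<omega>. card (\<Phi> \<omega> \<inter> B)) \<in> measurable P (count_space UNIV)"
  using measurable_compose[OF measurable_Phi measurable_card_Int[OF assms]] .

lemma prob_count:
  fixes B :: "'a set"
  assumes "B \<in> sets borel" "bounded B"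
  shows "prob {\<omega> \<in> space P. card (\<Phi> \<omega> \<inter> B) = n} =
    exp (- (lam * measure lborel B)) * (lam * measure lborel B) ^ n / fact n"
  using ppp assms unfolding homogeneous_ppp_def by blast

lemma bounded_annulus: "bounded (cball 0 t - cball 0 s :: 'a set)"
  by (rule bounded_subset[OF bounded_cball]) auto

lemma N_mono: "\<omega> \<in> space P \<Longrightarrow> s \<le> t \<Longrightarrow> N \<omega> s \<le> N \<omega> t"
  by (intro card_Int_cball_mono locally_finite_Phi)

lemma count_annulus:
  "\<omega> \<in> space P \<Longrightarrow> s \<le> t \<Longrightarrow> card (\<Phi> \<omega> \<inter> (cball 0 t - cball 0 s)) = N \<omega> t - N \<omega> s"
  by (intro card_Int_annulus locally_finite_Phi)

lemma measure_annulus: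
  assumes "s \<le> t"
  shows "measure lborel (cball 0 t - cball 0 s :: 'a set) =
    vol (cball (0::'a) t) - vol (cball (0::'a) s)"
  using assms
  by (intro measurable_measure_Diff) (auto intro!: fmeasurableI emeasure_bounded_finite)

text \<open>Fewer than \<open>i\<close> points in the ball of radius n has as probability a finite
  sum of Poisson terms, each of which vanishes as the mean grows with n. Hence all nearest distances
  are almost surely well specified.\<close>

lemma AE_ex_radius: "AE \<omega> in P. \<exists>R. i \<le> N \<omega> R"
proof -
  define Z where "Z = {\<omega> \<in> space P. \<forall>n::nat. N \<omega> (real n) < i}"
  have Z: "Z \<in> events" unfolding Z_def by measurable
  define x where "x n = lam * vol (cball (0::'a) (real n))" for n :: nat
  have "prob Z \<le> (\<Sum>k<i. exp (- x n) * x n ^ k / fact k)" for n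
  proof -
    have "prob Z \<le> prob (\<Union>k\<in>{..<i}. {\<omega> \<in> space P. N \<omega> (real n) = k})"
      by (intro finite_measure_mono) (auto simp: Z_def)
    also have "\<dots> \<le> (\<Sum>k<i. prob {\<omega> \<in> space P. N \<omega> (real n) = k})"
      by (intro finite_measure_subadditive_finite) auto
    also have "\<dots> = (\<Sum>k<i. exp (- x n) * x n ^ k / fact k)"
      by (intro sum.cong refl) (simp add: prob_count x_def)
    finally show ?thesis .
  qed
  moreover have "(\<lambda>n. \<Sum>k<i. exp (- x n) * x n ^ k / fact k) \<longlonglongrightarrow> 0"
  proof (rule tendsto_null_sum)
    fix k
    have c: "0 < unit_ball_vol (real DIM('a))" by (intro unit_ball_vol_pos) simp
    have "filterlim (\<lambda>n. lam * unit_ball_vol (real DIM('a)) * real n ^ DIM('a)) at_top sequentially"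
      using c lam_pos
      by (intro filterlim_tendsto_pos_mult_at_top[OF tendsto_const] filterlim_pow_at_top
          filterlim_real_sequentially) auto
    then have "filterlim x at_top sequentially"
      by (simp add: x_def[abs_def] content_cball mult.assoc)
    from filterlim_compose[OF tendsto_power_div_exp_0[of k] this]
    have "(\<lambda>n. x n ^ k / exp (x n) / fact k) \<longlonglongrightarrow> 0 / fact k"
      by (intro tendsto_divide tendsto_const) auto
    then show "(\<lambda>n. exp (- x n) * x n ^ k / fact k) \<longlonglongrightarrow> 0"
      by (simp add: exp_minus field_simps)
  qed
  ultimately have "prob Z \<le> 0" by (intro LIMSEQ_le_const) auto
  then have "prob Z = 0" using measure_nonneg[of P Z] by linarith
  then have "AE \<omega> in P. \<omega> \<notin> Z"
    using Z by (intro AE_not_in) (auto simp: null_sets_def emeasure_eq_measure)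
  with AE_space show ?thesis by eventually_elim (auto simp: Z_def not_less)
qed

text \<open>The ball of radius 0 is a Lebesgue null set, so its count has mean 0.\<close>

lemma AE_count_origin: "AE \<omega> in P. N \<omega> 0 = 0"
proof -
  have "prob {\<omega> \<in> space P. N \<omega> 0 = 0} = 1" by (subst prob_count) auto
  from AE_prob_1[OF this] show ?thesis by eventually_elim auto
qed

text \<open>With mean x the probability is 1 - exp(-x) (1 + x), and exp(-x) \<ge> 1 - x bounds it by
  x squared. The quadratic order is what makes sums over fine partitions vanish.\<close>

lemma prob_count_ge_2:
  fixes B :: "'a set"
  assumes [measurable]: "B \<in> sets borel" "bounded B"
  shows "prob {\<omega> \<in> space P. 2 \<le> card (\<Phi> \<omega> \<inter> B)} \<le> (lam * measure lborel B)\<^sup>2"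
proof -
  define x where "x = lam * measure lborel B"
  have x: "0 \<le> x" using lam_pos by (simp add: x_def)
  let ?E = "\<lambda>n. {\<omega> \<in> space P. card (\<Phi> \<omega> \<inter> B) = n}"
  have "prob (space P - (?E 0 \<union> ?E 1)) = 1 - prob (?E 0 \<union> ?E 1)"
    by (intro prob_compl) (auto simp: assms)
  also have "prob (?E 0 \<union> ?E 1) = prob (?E 0) + prob (?E 1)"
    by (intro finite_measure_Union) (auto simp: assms)
  also have "space P - (?E 0 \<union> ?E 1) = {\<omega> \<in> space P. 2 \<le> card (\<Phi> \<omega> \<inter> B)}" by auto
  finally have "prob {\<omega> \<in> space P. 2 \<le> card (\<Phi> \<omega> \<inter> B)} = 1 - exp (-x) * (1 + x)"
    using prob_count[OF assms, of 0] prob_count[OF assms, of 1] by (simp add: x_def algebra_simps)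
  moreover have "(1 - x) * (1 + x) \<le> exp (-x) * (1 + x)"
    using exp_ge_add_one_self[of "-x"] x by (intro mult_right_mono) auto
  ultimately show ?thesis by (simp add: x_def power2_eq_square algebra_simps)
qed

text \<open>The annuli are chosen with equal volumes, so that the \<open>n\<close> bounds of order \<open>1 / n\<^sup>2\<close> on the
  probability of two points in one of them sum up to \<open>O(1 / n)\<close>.\<close>

lemma AE_no_accumulation_below:
  fixes T :: nat
  shows "AE \<omega> in P. \<forall>\<rho>::real. 0 < \<rho> \<and> \<rho> \<le> real T \<longrightarrow> (\<exists>s<\<rho>. N \<omega> \<rho> < N \<omega> s + 2)"
proof -
  define d where "d = DIM('a)"
  have d: "0 < d" by (simp add: d_def)
  \<comment> \<open>Volume grows with the d-th power of the radius, so the d-th root makes the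
    volume of the k-th ball linear in \<open>k\<close>.\<close>
  define t where "t n k = real T * root d (real k / real n)" for n k :: nat
  define U where "U n = (\<Union>k<n. {\<omega> \<in> space P.
      2 \<le> card (\<Phi> \<omega> \<inter> (cball 0 (t n (Suc k)) - cball 0 (t n k)))})" for n
  have t_mono: "t n k \<le> t n (Suc k)" for n k
    using d by (auto simp: t_def intro!: mult_left_mono divide_right_mono)
  have t_nonneg: "0 \<le> t n k" for n k using d by (simp add: t_def)
  have Vt: "vol (cball (0::'a) (t n k)) = vol (cball (0::'a) T) * (real k / real n)" for n k
    using d t_nonneg by (simp add: content_cball t_def power_mult_distrib flip: d_def)
  have [measurable]: "U n \<in> events" for n unfolding U_def using bounded_annulus by measurable
  have U_le: "prob (U n) \<le> (lam * vol (cball (0::'a) T))\<^sup>2 / n" if "0 < n" for n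
  proof -
    have "prob (U n) \<le> (\<Sum>k<n. prob {\<omega> \<in> space P.
        2 \<le> card (\<Phi> \<omega> \<inter> (cball 0 (t n (Suc k)) - cball 0 (t n k)))})"
      unfolding U_def using bounded_annulus
      by (intro finite_measure_subadditive_finite) (auto, measurable)
    also have "\<dots> \<le> (\<Sum>k<n. (lam * (vol (cball (0::'a) T) / n))\<^sup>2)"
    proof (intro sum_mono)
      fix k
      have "prob {\<omega> \<in> space P. 2 \<le> card (\<Phi> \<omega> \<inter> (cball 0 (t n (Suc k)) - cball 0 (t n k)))}
          \<le> (lam * measure lborel (cball 0 (t n (Suc k)) - cball 0 (t n k) :: 'a set))\<^sup>2"
        by (intro prob_count_ge_2 bounded_annulus) auto
      also have "measure lborel (cball 0 (t n (Suc k)) - cball 0 (t n k) :: 'a set) = vol (cball (0::'a) T) / n"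
        unfolding measure_annulus[OF t_mono] Vt using that by (simp add: field_simps)
      finally show "prob {\<omega> \<in> space P. 2 \<le> card (\<Phi> \<omega> \<inter> (cball 0 (t n (Suc k)) - cball 0 (t n k)))}
          \<le> (lam * (vol (cball (0::'a) T) / n))\<^sup>2" .
    qed
    also have "\<dots> = (lam * vol (cball (0::'a) T))\<^sup>2 / n"
      using that by (simp add: power2_eq_square)
    finally show ?thesis .
  qed
  \<comment> \<open>On \<open>Z\<close> every subdivision has an annulus with two points. Its
    probability lies below a constant over n + 1 for every n, hence is 0.\<close>
  define Z where "Z = (\<Inter>n. U (Suc n))"
  have Z: "Z \<in> events" unfolding Z_def by measurable
  have le: "prob Z \<le> (lam * vol (cball (0::'a) T))\<^sup>2 / Suc n" for n
  proof -
    have "prob Z \<le> prob (U (Suc n))" by (intro finite_measure_mono) (auto simp: Z_def)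
    with U_le[of "Suc n"] show ?thesis by linarith
  qed
  have lim: "(\<lambda>n. (lam * vol (cball (0::'a) T))\<^sup>2 / Suc n) \<longlonglongrightarrow> 0"
    using LIMSEQ_Suc[OF lim_const_over_n] by simp
  have "prob Z \<le> 0" by (rule LIMSEQ_le_const[OF lim]) (use le in blast)
  then have "prob Z = 0" using measure_nonneg[of P Z] by linarith
  then have AE_Z: "AE \<omega> in P. \<omega> \<notin> Z"
    using Z by (intro AE_not_in) (auto simp: null_sets_def emeasure_eq_measure)
  \<comment> \<open>The inequality says that at most one point has norm in the interval from s
    (excluded) to \<rho> (included), and therefore at most one has norm exactly \<rho>. A single
    null set serves all the uncountably many \<rho>.\<close>
  have "\<exists>s<\<rho>. N \<omega> \<rho> < N \<omega> s + 2"
    if \<omega>: "\<omega> \<in> space P" "\<omega> \<notin> Z" and \<rho>: "0 < \<rho>" "\<rho> \<le> real T" for \<omega> and \<rho> :: real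
  proof -
    from \<omega> obtain n where n: "\<omega> \<notin> U (Suc n)" by (auto simp: Z_def)
    \<comment> \<open>The first grid radius that reaches \<rho>. It is not the one at index 0, which
      is 0, so its predecessor lies below \<rho> and supplies the witness \<open>s\<close>: the
      annulus between the two holds at most one point.\<close>
    define k where "k = (LEAST k. \<rho> \<le> t (Suc n) k)"
    have ex: "\<rho> \<le> t (Suc n) (Suc n)" using \<rho> d by (simp add: t_def)
    have k: "\<rho> \<le> t (Suc n) k" unfolding k_def using ex by (rule LeastI)
    have k_le: "k \<le> Suc n" unfolding k_def using ex by (rule Least_le)
    have "t (Suc n) 0 = 0" by (simp add: t_def)
    with k \<rho> have "k \<noteq> 0" by (intro notI) simp
    then obtain j where j: "k = Suc j" using not0_implies_Suc by blast
    then have "j < k" by simp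
    then have lt: "t (Suc n) j < \<rho>" unfolding k_def by (metis not_less_Least not_le)
    have "\<not> 2 \<le> card (\<Phi> \<omega> \<inter> (cball 0 (t (Suc n) (Suc j)) - cball 0 (t (Suc n) j)))"
      using n k_le j \<omega> by (auto simp: U_def)
    then have "N \<omega> (t (Suc n) k) < N \<omega> (t (Suc n) j) + 2"
      unfolding count_annulus[OF \<omega>(1) t_mono] j by simp
    then have "N \<omega> \<rho> < N \<omega> (t (Suc n) j) + 2" using N_mono[OF \<omega>(1) k] by simp
    with lt show ?thesis by blast
  qed
  note no_acc = this
  from AE_space AE_Z show ?thesis by eventually_elim (use no_acc in blast)
qed

section \<open>Strict order of the nearest distances and their law on ordered boxes\<close>

lemma nth_nearest_dist_Phi_le_iff:
  assumes "\<omega> \<in> space P" "\<forall>i. \<exists>R. i \<le> N \<omega> R" "1 \<le> i"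
  shows "nth_nearest_dist i (\<Phi> \<omega>) \<le> r \<longleftrightarrow> i \<le> N \<omega> r"
  using assms by (intro nth_nearest_dist_le_iff locally_finite_Phi) auto

lemma AE_all_ex_radius: "AE \<omega> in P. \<forall>i. \<exists>R. i \<le> N \<omega> R"
  using AE_ex_radius by (subst AE_all_countable) blast

text \<open>If the distances \<open>i\<close> and \<open>Suc i\<close> coincided at \<rho>, the ball
  of radius \<rho> would hold \<open>Suc i\<close> points. Since at most one of them is lost on
  passing to some smaller radius s, at least \<open>i\<close> points would already lie within s,
  contradicting that the \<open>i\<close>-th distance is \<rho>. Positivity holds because no point
  sits at the origin.\<close>

lemma AE_nth_nearest_dist_strict:
  "AE \<omega> in P. 0 < nth_nearest_dist 1 (\<Phi> \<omega>) \<and>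
    (\<forall>i\<ge>1. nth_nearest_dist i (\<Phi> \<omega>) < nth_nearest_dist (Suc i) (\<Phi> \<omega>))"
proof -
  have "AE \<omega> in P. \<forall>T::nat. \<forall>\<rho>::real. 0 < \<rho> \<and> \<rho> \<le> real T \<longrightarrow> (\<exists>s<\<rho>. N \<omega> \<rho> < N \<omega> s + 2)"
    using AE_no_accumulation_below by (subst AE_all_countable) blast
  with AE_space AE_all_ex_radius AE_count_origin show ?thesis
  proof eventually_elim
    case (elim \<omega>)
    note le_iff = nth_nearest_dist_Phi_le_iff[OF elim(1,2)]
    have pos: "0 < nth_nearest_dist i (\<Phi> \<omega>)" if "1 \<le> i" for i
      using le_iff[OF that, of 0] elim(3) that by auto
    have "nth_nearest_dist i (\<Phi> \<omega>) < nth_nearest_dist (Suc i) (\<Phi> \<omega>)" if i: "1 \<le> i" for i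
    proof (rule ccontr)
      define \<rho> where "\<rho> = nth_nearest_dist i (\<Phi> \<omega>)"
      assume "\<not> ?thesis"
      then have "Suc i \<le> N \<omega> \<rho>" using le_iff[of "Suc i" \<rho>] by (simp add: \<rho>_def)
      obtain T :: nat where "\<rho> \<le> real T" using real_arch_simple by blast
      with elim(4) pos[OF i] obtain s where s: "s < \<rho>" "N \<omega> \<rho> < N \<omega> s + 2"
        unfolding \<rho>_def by blast
      with \<open>Suc i \<le> N \<omega> \<rho>\<close> have "i \<le> N \<omega> s" by simp
      then have "\<rho> \<le> s" using le_iff[OF i, of s] by (simp add: \<rho>_def)
      with s show False by simp
    qed
    with pos show ?case by blast
  qed
qed

text \<open>The \<open>K\<close> intervals and the gaps before them cut the ball of radius
  \<open>b K\<close> into \<open>2 * K\<close> annuli with independent counts. In the product of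
  their probabilities the exponentials telescope: what remains is a volume factor for each of the
  first \<open>K - 1\<close> intervals and a difference of two exponentials from the last
  one.\<close>

lemma prob_nth_nearest_dist_box:
  assumes "1 \<le> K" and a1: "0 \<le> a 1"
    and ab: "\<And>i. i \<in> {1..K} \<Longrightarrow> a i < b i" and ba: "\<And>i. i \<in> {1..<K} \<Longrightarrow> b i \<le> a (Suc i)"
  shows "prob {\<omega> \<in> space P. \<forall>i\<in>{1..K}. nth_nearest_dist i (\<Phi> \<omega>) \<in> {a i<..b i}} =
    (\<Prod>i\<in>{1..<K}. lam * (vol (cball (0::'a) (b i)) - vol (cball (0::'a) (a i)))) *
    (exp (- (lam * vol (cball (0::'a) (a K)))) - exp (- (lam * vol (cball (0::'a) (b K)))))"
proof -
  define v where "v t = vol (cball (0::'a) t)" for t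
  \<comment> \<open>A ball of radius -1 is empty, so the first gap is the whole closed ball of
    radius \<open>a 1\<close>, origin included.\<close>
  define b0 where "b0 i = (if i = 0 then - 1 else b i)" for i
  \<comment> \<open>The endpoints interleaved: annulus \<open>2 * i\<close> is the gap from
    \<open>b0 i\<close> to \<open>a (Suc i)\<close>, annulus \<open>Suc (2 * i)\<close> belongs to
    the interval from \<open>a (Suc i)\<close> to \<open>b (Suc i)\<close>.\<close>
  define t where "t j = (if even j then b0 (j div 2) else a (Suc (j div 2)))" for j
  have t_even: "t (2 * i) = b0 i" and t_odd: "t (Suc (2 * i)) = a (Suc i)" for i
    by (simp_all add: t_def)
  have b0_a: "b0 i \<le> a (Suc i)" if "i < K" for i
    using that a1 ba[of i] by (auto simp: b0_def)
  have a_b0: "a (Suc i) \<le> b0 (Suc i)" if "i < K" for i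
    using that ab[of "Suc i"] by (auto simp: b0_def)
  have t_Suc: "t j \<le> t (Suc j)" if "j < 2 * K" for j
  proof (cases "even j")
    case True
    then obtain i where "j = 2 * i" by blast
    with that b0_a[of i] show ?thesis by (simp add: t_even t_odd)
  next
    case False
    then obtain i where "j = Suc (2 * i)" using oddE by fastforce
    with that a_b0[of i] t_even[of "Suc i"] show ?thesis by (simp add: t_odd)
  qed
  have t_mono: "t i \<le> t j" if "i \<le> j" "j \<le> 2 * K" for i j
    using that by (induction rule: dec_induct) (use t_Suc order_trans in \<open>force+\<close>)
  define D where "D j = (cball 0 (t (Suc j)) - cball 0 (t j) :: 'a set)" for j
  have D: "D j \<in> sets borel" "bounded (D j)" for j
    by (simp_all add: D_def bounded_annulus)
  have disj: "disjoint_family_on D {..<2 * K}"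
  proof -
    have "D i \<inter> D j = {}" if "i < j" "j < 2 * K" for i j
      using t_mono[of "Suc i" j] that by (auto simp: D_def)
    then show ?thesis
      unfolding disjoint_family_on_def by (metis Int_commute lessThan_iff linorder_neqE_nat)
  qed
  define X where "X j \<omega> = card (\<Phi> \<omega> \<inter> D j)" for j \<omega>
  have X_meas [measurable]: "X j \<in> measurable P (count_space UNIV)" for j
    unfolding X_def using D by measurable
  have indep: "indep_vars (\<lambda>_. count_space UNIV) X {..<2 * K}"
    using ppp D disj unfolding homogeneous_ppp_def X_def by blast
  \<comment> \<open>Prescribed counts: none in a gap, one in the annulus of an interval. The last
    annulus may hold more, since points beyond the \<open>K\<close>-th can lie there too.\<close>
  define C where "C j = (if even j then {0::nat} else if Suc j = 2 * K then {1..} else {1})" for j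
  define p where "p j = prob (X j -` C j \<inter> space P)" for j
  have X_eq: "X j \<omega> = N \<omega> (t (Suc j)) - N \<omega> (t j)"
    and N_t: "N \<omega> (t j) \<le> N \<omega> (t (Suc j))" if "\<omega> \<in> space P" "j < 2 * K" for j \<omega>
    using that t_Suc by (auto simp: X_def D_def count_annulus intro!: N_mono)
  have prob_X: "prob (X j -` {n} \<inter> space P) =
      exp (- (lam * (v (t (Suc j)) - v (t j)))) * (lam * (v (t (Suc j)) - v (t j))) ^ n / fact n"
    if "j < 2 * K" for j n
  proof -
    have "X j -` {n} \<inter> space P = {\<omega> \<in> space P. card (\<Phi> \<omega> \<inter> D j) = n}" by (auto simp: X_def)
    then show ?thesis
      using prob_count[OF D, of j n] measure_annulus[OF t_Suc[OF that]]
      by (simp add: D_def v_def)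
  qed
  have p_even: "p (2 * i) = exp (- (lam * (v (a (Suc i)) - v (b0 i))))" if "i < K" for i
    using that prob_X[of "2 * i" 0] by (simp add: p_def C_def t_even t_odd)
  have p_odd: "p (Suc (2 * i)) = exp (- (lam * (v (b (Suc i)) - v (a (Suc i))))) *
      (lam * (v (b (Suc i)) - v (a (Suc i))))" if "Suc i < K" for i
    using that prob_X[of "Suc (2 * i)" 1] t_even[of "Suc i"]
    by (simp add: p_def C_def t_odd b0_def)
  obtain k where k: "K = Suc k" using \<open>1 \<le> K\<close> not0_implies_Suc[of K] by auto
  have p_last: "p (Suc (2 * k)) = 1 - exp (- (lam * (v (b K) - v (a K))))"
  proof -
    have "X (Suc (2 * k)) -` {1..} \<inter> space P = space P - (X (Suc (2 * k)) -` {0} \<inter> space P)"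
      by auto
    then have "p (Suc (2 * k)) = 1 - prob (X (Suc (2 * k)) -` {0} \<inter> space P)"
      by (simp add: p_def C_def k prob_compl)
    also have "prob (X (Suc (2 * k)) -` {0} \<inter> space P) = exp (- (lam * (v (b K) - v (a K))))"
      using prob_X[of "Suc (2 * k)" 0] t_even[of "Suc k"] by (simp add: k t_odd b0_def)
    finally show ?thesis .
  qed
  \<comment> \<open>Up to \<open>b0 n\<close> the volumes of the annuli add up to that of a ball,
    which collapses the exponentials. The last interval, whose factor has another form, stays
    outside this induction.\<close>
  have prod_p: "(\<Prod>j<2 * n. p j) =
      exp (- (lam * v (b0 n))) * (\<Prod>i\<in>{1..<Suc n}. lam * (v (b i) - v (a i)))" if "n \<le> k" for n
    using that
  proof (induction n)
    case 0
    then show ?case by (simp add: b0_def v_def)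
  next
    case (Suc n)
    have "(\<Prod>j<2 * Suc n. p j) = (\<Prod>j<2 * n. p j) * p (2 * n) * p (Suc (2 * n))"
      by (simp add: mult.assoc)
    also have "\<dots> = (exp (- (lam * v (b0 n))) * exp (- (lam * (v (a (Suc n)) - v (b0 n)))) *
          exp (- (lam * (v (b (Suc n)) - v (a (Suc n)))))) *
        ((\<Prod>i\<in>{1..<Suc n}. lam * (v (b i) - v (a i))) * (lam * (v (b (Suc n)) - v (a (Suc n)))))"
      using Suc k by (simp add: p_even p_odd)
    also have "exp (- (lam * v (b0 n))) * exp (- (lam * (v (a (Suc n)) - v (b0 n)))) *
          exp (- (lam * (v (b (Suc n)) - v (a (Suc n))))) = exp (- (lam * v (b0 (Suc n))))"
      by (simp add: b0_def algebra_simps flip: exp_add)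
    finally show ?case by (simp add: prod.atLeastLessThan_Suc)
  qed
  have "(\<Prod>j<2 * K. p j) = (\<Prod>j<2 * k. p j) * p (2 * k) * p (Suc (2 * k))"
    by (simp add: k mult.assoc)
  also have "\<dots> = (\<Prod>i\<in>{1..<K}. lam * (v (b i) - v (a i))) *
      ((exp (- (lam * v (b0 k))) * exp (- (lam * (v (a K) - v (b0 k))))) *
       (1 - exp (- (lam * (v (b K) - v (a K))))))"
    unfolding prod_p[OF order.refl] p_last using p_even[of k] by (simp add: k)
  also have "exp (- (lam * v (b0 k))) * exp (- (lam * (v (a K) - v (b0 k)))) = exp (- (lam * v (a K)))"
    by (simp add: algebra_simps flip: exp_add)
  also have "exp (- (lam * v (a K))) * (1 - exp (- (lam * (v (b K) - v (a K))))) =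
      exp (- (lam * v (a K))) - exp (- (lam * v (b K)))"
    by (simp add: algebra_simps flip: exp_add)
  finally have prod_eq: "(\<Prod>j<2 * K. p j) = (\<Prod>i\<in>{1..<K}. lam * (v (b i) - v (a i))) *
      (exp (- (lam * v (a K))) - exp (- (lam * v (b K))))" .
  have iff: "(\<forall>i\<in>{1..K}. nth_nearest_dist i (\<Phi> \<omega>) \<in> {a i<..b i}) \<longleftrightarrow> (\<forall>j<2 * K. X j \<omega> \<in> C j)"
    if \<omega>: "\<omega> \<in> space P" "\<forall>i. \<exists>R. i \<le> N \<omega> R" for \<omega>
  proof -
    have "(\<forall>i\<in>{1..K}. nth_nearest_dist i (\<Phi> \<omega>) \<in> {a i<..b i}) \<longleftrightarrow>
        (\<forall>i\<in>{1..K}. N \<omega> (a i) < i \<and> i \<le> N \<omega> (b i))"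
      using nth_nearest_dist_Phi_le_iff[OF \<omega>] by (auto simp: not_le[symmetric])
    \<comment> \<open>Indices now start at 0, matching the numbering of the annuli.\<close>
    also have "\<dots> \<longleftrightarrow> (\<forall>i<K. N \<omega> (a (Suc i)) \<le> i \<and> Suc i \<le> N \<omega> (b0 (Suc i)))"
      (is "?L \<longleftrightarrow> ?M")
    proof
      assume L: ?L
      show ?M
      proof (intro allI impI)
        fix i assume "i < K"
        with L have "N \<omega> (a (Suc i)) < Suc i \<and> Suc i \<le> N \<omega> (b (Suc i))" by simp
        then show "N \<omega> (a (Suc i)) \<le> i \<and> Suc i \<le> N \<omega> (b0 (Suc i))" by (simp add: b0_def)
      qed
    next
      assume M: ?M
      show ?L
      proof
        fix i assume "i \<in> {1..K}"
        then obtain i' where "i = Suc i'" "i' < K" by (cases i) auto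
        with M show "N \<omega> (a i) < i \<and> i \<le> N \<omega> (b i)" by (auto simp: b0_def less_Suc_eq_le)
      qed
    qed
    also have "\<dots> \<longleftrightarrow> (\<forall>j<2 * K. X j \<omega> \<in> C j)"
    proof
      assume L: ?M
      have b0_ge: "i \<le> N \<omega> (b0 i)" if "i \<le> K" for i
        using L that by (cases i) auto
      \<comment> \<open>Squeezed between i \<le> N(b i) and N(a (i + 1)) \<le> i, since b i \<le> a
        (i + 1).\<close>
      have a_eq: "N \<omega> (a (Suc i)) = i" if "i < K" for i
        using L N_mono[OF \<omega>(1) b0_a[OF that]] b0_ge[of i] that by fastforce
      show "\<forall>j<2 * K. X j \<omega> \<in> C j"
      proof (intro allI impI)
        fix j assume j: "j < 2 * K"
        show "X j \<omega> \<in> C j"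
        proof (cases "even j")
          case True
          then obtain i where i: "j = 2 * i" by blast
          with j have "i < K" by simp
          then show ?thesis
            using X_eq[OF \<omega>(1) j] a_eq[of i] b0_ge[of i] by (simp add: i C_def t_even t_odd)
        next
          case False
          then obtain i where i: "j = Suc (2 * i)" using oddE by fastforce
          with j have "i < K" by simp
          have X: "X j \<omega> = N \<omega> (b0 (Suc i)) - i"
            using X_eq[OF \<omega>(1) j] a_eq[OF \<open>i < K\<close>] t_even[of "Suc i"] by (simp add: i t_odd)
          show ?thesis
          proof (cases "Suc i = K")
            case True
            then show ?thesis using X b0_ge[of K] by (simp add: C_def i)
          next
            case False
            with \<open>i < K\<close> have "Suc i < K" by simp
            then have "N \<omega> (b0 (Suc i)) = Suc i"
              using b0_ge[of "Suc i"] N_mono[OF \<omega>(1) b0_a[of "Suc i"]] a_eq[of "Suc i"] by simp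
            then show ?thesis using X False by (simp add: C_def i)
          qed
        qed
      qed
    next
      assume R: "\<forall>j<2 * K. X j \<omega> \<in> C j"
      \<comment> \<open>Subtraction of counts truncates at 0, so a zero difference gives one
        inequality only; monotonicity in \<open>N_t\<close> supplies the other.\<close>
      have even: "N \<omega> (a (Suc i)) = N \<omega> (b0 i)" if "i < K" for i
        using R[rule_format, of "2 * i"] X_eq[OF \<omega>(1), of "2 * i"] N_t[OF \<omega>(1), of "2 * i"] that
        by (simp add: C_def t_even t_odd)
      have odd: "Suc (N \<omega> (a (Suc i))) \<le> N \<omega> (b0 (Suc i))" if "i < K" for i
        using R[rule_format, of "Suc (2 * i)"] X_eq[OF \<omega>(1), of "Suc (2 * i)"] that
          t_even[of "Suc i"]
        by (auto simp: C_def t_odd split: if_splits)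
      have odd': "N \<omega> (b0 (Suc i)) = Suc (N \<omega> (a (Suc i)))" if "Suc i < K" for i
        using R[rule_format, of "Suc (2 * i)"] X_eq[OF \<omega>(1), of "Suc (2 * i)"] that
          t_even[of "Suc i"]
        by (simp add: C_def t_odd)
      \<comment> \<open>The counts add up outwards from the empty ball of radius
        \<open>b0 0\<close>.\<close>
      have "N \<omega> (b0 i) = i" if "i < K" for i
        using that
      proof (induction i)
        case 0
        then show ?case by (simp add: b0_def)
      next
        case (Suc i)
        then show ?case using odd'[of i] even[of i] by simp
      qed
      with even odd show ?M by (metis order.refl)
    qed
    finally show ?thesis .
  qed
  have nth_meas [measurable]: "(\<lambda>\<omega>. nth_nearest_dist i (\<Phi> \<omega>)) \<in> borel_measurable P"
    if "1 \<le> i" for i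
    using measurable_compose[OF measurable_Phi measurable_nth_nearest_dist[OF that]] .
  have "prob {\<omega> \<in> space P. \<forall>i\<in>{1..K}. nth_nearest_dist i (\<Phi> \<omega>) \<in> {a i<..b i}} =
      prob (\<Inter>j\<in>{..<2 * K}. X j -` C j \<inter> space P)"
  proof (rule finite_measure_eq_AE)
    show "AE \<omega> in P. \<omega> \<in> {\<omega> \<in> space P. \<forall>i\<in>{1..K}. nth_nearest_dist i (\<Phi> \<omega>) \<in> {a i<..b i}} \<longleftrightarrow>
        \<omega> \<in> (\<Inter>j\<in>{..<2 * K}. X j -` C j \<inter> space P)"
      using AE_space AE_all_ex_radius
    proof eventually_elim
      case (elim \<omega>)
      show ?case using iff[OF elim] elim(1) \<open>1 \<le> K\<close> by auto
    qed
    show "{\<omega> \<in> space P. \<forall>i\<in>{1..K}. nth_nearest_dist i (\<Phi> \<omega>) \<in> {a i<..b i}} \<in> events"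
      by (intro sets.sets_Collect_finite_All') (use \<open>1 \<le> K\<close> in auto)
    show "(\<Inter>j\<in>{..<2 * K}. X j -` C j \<inter> space P) \<in> events"
    proof (rule sets.finite_INT)
      have "0 \<in> {..<2 * K}" using \<open>1 \<le> K\<close> by simp
      then show "{..<2 * K} \<noteq> {}" by blast
    qed (auto intro: measurable_sets[OF X_meas])
  qed
  also have "\<dots> = (\<Prod>j<2 * K. p j)"
  proof -
    have "0 \<in> {..<2 * K}" using \<open>1 \<le> K\<close> by simp
    then have "{..<2 * K} \<noteq> {}" by blast
    then show ?thesis unfolding p_def by (rule indep_varsD[OF indep]) auto
  qed
  finally show ?thesis unfolding prod_eq v_def .
qed

section \<open>Void probabilities and the distance to the nearest point\<close>

lemma AE_Phi_nonempty: "AE \<omega> in P. \<Phi> \<omega> \<noteq> {}"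
  using AE_ex_radius[of 1] by eventually_elim auto

text \<open>Almost surely the event is that the closed ball of radius \<open>t\<close> is void. For
  negative \<open>t\<close> this ball is empty and both sides are 1.\<close>

lemma prob_less_infdist:
  "prob {\<omega> \<in> space P. t < infdist 0 (\<Phi> \<omega>)} = exp (- (lam * vol (cball (0::'a) t)))"
proof -
  note measurable_compose[OF measurable_Phi measurable_infdist_conf_space, measurable]
  have "prob {\<omega> \<in> space P. t < infdist 0 (\<Phi> \<omega>)} = prob {\<omega> \<in> space P. N \<omega> t = 0}"
  proof (rule finite_measure_eq_AE)
    show "AE \<omega> in P. \<omega> \<in> {\<omega> \<in> space P. t < infdist 0 (\<Phi> \<omega>)} \<longleftrightarrow> \<omega> \<in> {\<omega> \<in> space P. N \<omega> t = 0}"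
      using AE_space AE_Phi_nonempty
      by eventually_elim (simp add: less_infdist_iff locally_finite_Phi)
  qed auto
  also have "\<dots> = exp (- (lam * vol (cball (0::'a) t)))" by (subst prob_count) auto
  finally show ?thesis .
qed

text \<open>Discards the null event of distance 0, where the convention \<open>0 powr x = 0\<close>
  would break the equivalence between comparing received powers and comparing distances.\<close>

lemma AE_infdist_pos: "AE \<omega> in P. 0 < infdist 0 (\<Phi> \<omega>)"
  using AE_space AE_Phi_nonempty AE_count_origin
  by eventually_elim (simp add: less_infdist_iff locally_finite_Phi)

end

section \<open>The ordered region and the boxes that generate its measurable sets\<close>

lemma ordered_region_sets:
  assumes "1 \<le> K"
  shows "ordered_region K \<in> sets (Pi\<^sub>M {1..K} (\<lambda>_. lborel))"
proof -
  let ?L = "Pi\<^sub>M {1..K} (\<lambda>_. lborel) :: (nat \<Rightarrow> real) measure"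
  have meas: "(\<lambda>r. r i) \<in> borel_measurable ?L" if "i \<in> {1..K}" for i
    using measurable_component_singleton[OF that, of "\<lambda>_. lborel"] by simp
  have "ordered_region K = {r \<in> space ?L. 0 < r 1 \<and> (\<forall>i\<in>{1..<K}. r i < r (Suc i))}"
    by (auto simp: ordered_region_def space_PiM)
  also have "\<dots> \<in> sets ?L"
    using assms by (intro sets.sets_Collect_conj sets.sets_Collect_finite_All
        borel_measurable_less borel_measurable_const meas) auto
  finally show ?thesis .
qed

lemma measurable_f_Lambda:
  assumes "1 \<le> K"
  shows "f_Lambda lam K \<in> borel_measurable (Pi\<^sub>M {1..K} (\<lambda>_. lborel))"
proof -
  have [measurable]: "(\<lambda>r. r i :: real) \<in> borel_measurable (Pi\<^sub>M {1..K} (\<lambda>_. lborel))"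
    if "i \<in> {1..K}" for i
    using measurable_component_singleton[OF that, of "\<lambda>_. lborel"] by simp
  note ordered_region_sets[OF assms, measurable]
  have "K \<in> {1..K}" using assms by simp
  then show ?thesis unfolding f_Lambda_def[abs_def] by measurable
qed

lemma ordered_region_pos:
  assumes r: "r \<in> ordered_region K" and "i \<in> {1..K}"
  shows "0 < r i"
proof -
  have "1 \<le> i" "i \<le> K" using assms by auto
  then show ?thesis
  proof (induction rule: dec_induct)
    case base
    then show ?case using r by (simp add: ordered_region_def)
  next
    case (step n)
    then have "r n < r (Suc n)" using r by (simp add: ordered_region_def)
    with step show ?case by simp
  qed
qed

lemma ordered_box_lower_nonneg:
  fixes a b :: "nat \<Rightarrow> real"
  assumes a1: "0 \<le> a 1" and ab: "\<And>i. i \<in> {1..K} \<Longrightarrow> a i < b i"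
    and ba: "\<And>i. i \<in> {1..<K} \<Longrightarrow> b i \<le> a (Suc i)" and "i \<in> {1..K}"
  shows "0 \<le> a i"
proof -
  have "1 \<le> i" "i \<le> K" using assms by auto
  then show ?thesis
  proof (induction rule: dec_induct)
    case (step n)
    then have "a n < b n" "b n \<le> a (Suc n)" by (auto intro: ab ba)
    with step show ?case by simp
  qed (rule a1)
qed

text \<open>Half-open sides let consecutive intervals share an endpoint while keeping the
  coordinates strictly increasing. Sides may be empty, which closes the family under
  intersection.\<close>

definition ordered_boxes :: "nat \<Rightarrow> (nat \<Rightarrow> real) set set" where
  "ordered_boxes K = {(\<Pi>\<^sub>E i\<in>{1..K}. {a i<..b i}) | a b.
     0 \<le> a 1 \<and> (\<forall>i\<in>{1..<K}. b i \<le> a (Suc i))}"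

lemma ordered_boxesI:
  "0 \<le> a 1 \<Longrightarrow> (\<And>i. i \<in> {1..<K} \<Longrightarrow> b i \<le> a (Suc i)) \<Longrightarrow>
    (\<Pi>\<^sub>E i\<in>{1..K}. {a i<..b i}) \<in> ordered_boxes K"
  unfolding ordered_boxes_def by blast

text \<open>Lower ends combine by maximum and upper ends by minimum, which can only move the upper
  end of one interval down and the lower end of the next up.\<close>

lemma Int_stable_ordered_boxes: "Int_stable (ordered_boxes K)"
proof (rule Int_stableI)
  fix A B assume "A \<in> ordered_boxes K" "B \<in> ordered_boxes K"
  then obtain a b c d where A: "A = (\<Pi>\<^sub>E i\<in>{1..K}. {a i<..b i})" "0 \<le> a 1"
      "\<And>i. i \<in> {1..<K} \<Longrightarrow> b i \<le> a (Suc i)"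
    and B: "B = (\<Pi>\<^sub>E i\<in>{1..K}. {c i<..d i})" "0 \<le> c 1"
      "\<And>i. i \<in> {1..<K} \<Longrightarrow> d i \<le> c (Suc i)"
    unfolding ordered_boxes_def by blast
  have "A \<inter> B = (\<Pi>\<^sub>E i\<in>{1..K}. {max (a i) (c i)<..min (b i) (d i)})"
    unfolding A B by (auto simp: PiE_Int)
  also have "\<dots> \<in> ordered_boxes K"
    using A(2) A(3) by (intro ordered_boxesI) (auto simp: le_max_iff_disj min_le_iff_disj)
  finally show "A \<inter> B \<in> ordered_boxes K" .
qed

lemma ordered_boxes_subset:
  assumes "1 \<le> K"
  shows "ordered_boxes K \<subseteq> Pow (ordered_region K)"
proof
  fix A assume "A \<in> ordered_boxes K"
  then obtain a b where A: "A = (\<Pi>\<^sub>E i\<in>{1..K}. {a i<..b i})" "0 \<le> a 1"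
      "\<And>i. i \<in> {1..<K} \<Longrightarrow> b i \<le> a (Suc i)"
    unfolding ordered_boxes_def by blast
  have "r \<in> ordered_region K" if "r \<in> A" for r
  proof -
    have r: "a i < r i" "r i \<le> b i" if "i \<in> {1..K}" for i
      using \<open>r \<in> A\<close> that by (auto simp: A(1) PiE_iff)
    have "0 < r 1" using r(1)[of 1] A(2) assms by simp
    moreover have "r i < r (Suc i)" if "i \<in> {1..<K}" for i
      using r(2)[of i] r(1)[of "Suc i"] A(3)[OF that] that by auto
    ultimately show ?thesis
      using \<open>r \<in> A\<close> by (auto simp: ordered_region_def A(1) PiE_iff)
  qed
  then show "A \<in> Pow (ordered_region K)" by auto
qed

lemma ordered_boxes_sets: "ordered_boxes K \<subseteq> sets (Pi\<^sub>M {1..K} (\<lambda>_. lborel))"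
  unfolding ordered_boxes_def by (auto intro!: sets_PiM_I_finite)

text \<open>Rationals are interleaved with the coordinates, q 1 < r 1 < q 2 < r 2 < ... < q (K + 1),
  with the one at \<open>i0\<close> chosen at or above \<open>c\<close>. Only countably many boxes
  arise in this way. They serve to cover the region and, through \<open>c\<close>, to express the
  sets where a coordinate exceeds a given level.\<close>

lemma ordered_region_cover_above:
  assumes r: "r \<in> ordered_region K" and "c < r i0" "i0 \<in> {1..K}"
  shows "\<exists>q\<in>{1..Suc K} \<rightarrow>\<^sub>E \<rat>. 0 \<le> q 1 \<and> c \<le> q i0 \<and> r \<in> (\<Pi>\<^sub>E i\<in>{1..K}. {q i<..q (Suc i)})"
proof -
  \<comment> \<open>The \<open>i\<close>-th rational is sought between \<open>l i\<close> and
    \<open>u i\<close>. After the last coordinate there is no upper constraint, and \<open>u\<close>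
    is put one above \<open>l (Suc K)\<close>, which is \<open>max (r K) 0\<close>.\<close>
  define l where "l i = max (if i = 1 then 0 else r (i - 1)) (if i = i0 then c else 0)" for i
  define u where "u i = (if i \<le> K then r i else max (r K) 0 + 1)" for i
  note pos = ordered_region_pos[OF r]
  have "\<exists>q\<in>\<rat>. l i < q \<and> q < u i" if i: "i \<in> {1..Suc K}" for i
  proof (rule Rats_dense_in_real)
    have "r (i - 1) < r i" if "i \<noteq> 1" "i \<le> K"
    proof -
      have "i - 1 \<in> {1..<K}" using that i by auto
      with r have "r (i - 1) < r (Suc (i - 1))" unfolding ordered_region_def by blast
      with that i show ?thesis by simp
    qed
    moreover have "i = Suc K" if "\<not> i \<le> K" using that i by simp
    ultimately show "l i < u i"
      using i assms(2,3) pos[of i] by (cases "i \<le> K") (auto simp: l_def u_def)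
  qed
  then obtain q where q: "\<And>i. i \<in> {1..Suc K} \<Longrightarrow> q i \<in> \<rat> \<and> l i < q i \<and> q i < u i"
    by metis
  let ?q = "restrict q {1..Suc K}"
  have "?q \<in> {1..Suc K} \<rightarrow>\<^sub>E \<rat>" using q by auto
  moreover have "0 \<le> ?q 1" using q[of 1] by (simp add: l_def)
  moreover have "c \<le> ?q i0" using q[of i0] assms(3) by (simp add: l_def)
  moreover have "r \<in> (\<Pi>\<^sub>E i\<in>{1..K}. {?q i<..?q (Suc i)})"
  proof (rule PiE_I)
    fix i assume i: "i \<in> {1..K}"
    then have "q i < r i" using q[of i] by (auto simp: u_def)
    moreover have "r i < q (Suc i)" using q[of "Suc i"] i by (auto simp: l_def)
    ultimately show "r i \<in> {?q i<..?q (Suc i)}" using i by simp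
  qed (use r in \<open>auto simp: ordered_region_def PiE_iff extensional_def\<close>)
  ultimately show ?thesis by blast
qed

lemma rational_box_in_ordered_boxes:
  "0 \<le> q 1 \<Longrightarrow> (\<Pi>\<^sub>E i\<in>{1..K}. {q i<..q (Suc i)}) \<in> ordered_boxes K"
  by (rule ordered_boxesI) auto

lemma countable_rational_functions: "countable ({1..Suc K} \<rightarrow>\<^sub>E (\<rat> :: real set))"
  by (intro countable_PiE countable_rat) auto

text \<open>Provides the countable cover by generators that uniqueness of measures asks for.\<close>

lemma ordered_region_eq_Union_boxes:
  assumes "1 \<le> K"
  shows "\<exists>A :: nat \<Rightarrow> _. range A \<subseteq> ordered_boxes K \<and> (\<Union>i. A i) = ordered_region K"
proof -
  define Q where "Q = {q \<in> {1..Suc K} \<rightarrow>\<^sub>E (\<rat> :: real set). 0 \<le> q 1}"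
  define box where "box q = (\<Pi>\<^sub>E i\<in>{1..K}. {q i<..q (Suc i) :: real})" for q
  have "countable Q"
    unfolding Q_def by (rule countable_subset[OF _ countable_rational_functions[of K]]) auto
  have "(\<lambda>i\<in>{1..Suc K}. 0) \<in> Q" by (auto simp: Q_def)
  then have "Q \<noteq> {}" by blast
  have "box q \<in> ordered_boxes K" if "q \<in> Q" for q
    unfolding box_def using that by (intro rational_box_in_ordered_boxes) (simp add: Q_def)
  then have sub: "range (\<lambda>n. box (from_nat_into Q n)) \<subseteq> ordered_boxes K"
    using from_nat_into[OF \<open>Q \<noteq> {}\<close>] by blast
  have "(\<Union>n. box (from_nat_into Q n)) = \<Union> (box ` range (from_nat_into Q))" by simp
  also have "\<dots> = \<Union> (box ` Q)"
    by (simp only: range_from_nat_into[OF \<open>Q \<noteq> {}\<close> \<open>countable Q\<close>])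
  also have "\<dots> = ordered_region K"
  proof
    show "\<Union> (box ` Q) \<subseteq> ordered_region K"
      using \<open>\<And>q. q \<in> Q \<Longrightarrow> box q \<in> ordered_boxes K\<close> ordered_boxes_subset[OF assms] by blast
    show "ordered_region K \<subseteq> \<Union> (box ` Q)"
    proof
      fix r assume r: "r \<in> ordered_region K"
      then obtain q where "q \<in> {1..Suc K} \<rightarrow>\<^sub>E \<rat>" "0 \<le> q 1" "r \<in> box q"
        \<comment> \<open>The level \<open>r 1 - 1\<close> is a dummy; any number below
          \<open>r 1\<close> serves.\<close>
        using ordered_region_cover_above[OF r, of "r 1 - 1" 1] assms unfolding box_def by auto
      then show "r \<in> \<Union> (box ` Q)" by (auto simp: Q_def)
    qed
  qed
  finally show ?thesis using sub by blast
qed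

text \<open>The boxes make each coordinate measurable: inside the region, the set where coordinate
  \<open>i\<close> exceeds c is the countable union of the rational boxes with c \<le> q i.
  Conversely each box is a measurable subset of the region.\<close>

lemma sets_restrict_ordered_region:
  assumes K: "1 \<le> K"
  shows "sets (restrict_space (Pi\<^sub>M {1..K} (\<lambda>_. lborel)) (ordered_region K)) =
    sigma_sets (ordered_region K) (ordered_boxes K)"
    (is "sets (restrict_space ?L ?R) = _")
proof
  define S where "S = sigma ?R (ordered_boxes K)"
  note sub = ordered_boxes_subset[OF K]
  have S: "space S = ?R" "sets S = sigma_sets ?R (ordered_boxes K)"
    using sub by (auto simp: S_def)
  have "(\<lambda>r. r) \<in> measurable S ?L"
  proof (rule measurable_PiM_single')
    show "(\<lambda>r. r) \<in> space S \<rightarrow> (\<Pi>\<^sub>E i\<in>{1..K}. space lborel)"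
      by (auto simp: S ordered_region_def)
    fix i assume i: "i \<in> {1..K}"
    have "(\<lambda>r. r i) \<in> borel_measurable S"
      unfolding borel_measurable_iff_greater
    proof
      fix c
      define Q where "Q = {q \<in> {1..Suc K} \<rightarrow>\<^sub>E (\<rat> :: real set). 0 \<le> q 1 \<and> c \<le> q i}"
      have Q: "countable Q"
        unfolding Q_def by (rule countable_subset[OF _ countable_rational_functions[of K]]) auto
      have boxS: "(\<Pi>\<^sub>E i\<in>{1..K}. {q i<..q (Suc i)}) \<in> sets S" if "q \<in> Q" for q
        unfolding S using that
        by (intro sigma_sets.Basic rational_box_in_ordered_boxes) (simp add: Q_def)
      have "{r \<in> space S. c < r i} = (\<Union>q\<in>Q. \<Pi>\<^sub>E i\<in>{1..K}. {q i<..q (Suc i)})"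
      proof
        show "{r \<in> space S. c < r i} \<subseteq> (\<Union>q\<in>Q. \<Pi>\<^sub>E i\<in>{1..K}. {q i<..q (Suc i)})"
        proof
          fix r assume "r \<in> {r \<in> space S. c < r i}"
          then have "r \<in> ?R" "c < r i" by (simp_all add: S)
          then obtain q where q: "q \<in> {1..Suc K} \<rightarrow>\<^sub>E \<rat>" "0 \<le> q 1 \<and> c \<le> q i"
              "r \<in> (\<Pi>\<^sub>E i\<in>{1..K}. {q i<..q (Suc i)})"
            using ordered_region_cover_above[OF _ _ i] by blast
          then have "q \<in> Q" unfolding Q_def by blast
          with q(3) show "r \<in> (\<Union>q\<in>Q. \<Pi>\<^sub>E i\<in>{1..K}. {q i<..q (Suc i)})" by (rule UN_I[rotated])
        qed
        show "(\<Union>q\<in>Q. \<Pi>\<^sub>E i\<in>{1..K}. {q i<..q (Suc i)}) \<subseteq> {r \<in> space S. c < r i}"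
        proof
          fix r assume "r \<in> (\<Union>q\<in>Q. \<Pi>\<^sub>E i\<in>{1..K}. {q i<..q (Suc i)})"
          then obtain q where q: "q \<in> Q" "r \<in> (\<Pi>\<^sub>E i\<in>{1..K}. {q i<..q (Suc i)})" by (rule UN_E)
          then have "q i < r i" using i by (auto simp: PiE_iff)
          moreover have "r \<in> space S"
            using sets.sets_into_space[OF boxS[OF q(1)]] q(2) by blast
          ultimately show "r \<in> {r \<in> space S. c < r i}" using q(1) by (auto simp: Q_def)
        qed
      qed
      also have "\<dots> \<in> sets S" using Q boxS by (intro sets.countable_UN') auto
      finally show "{r \<in> space S. c < r i} \<in> sets S" .
    qed
    then show "(\<lambda>r. r i) \<in> measurable S lborel" by simp
  qed
  note meas = this
  show "sets (restrict_space ?L ?R) \<subseteq> sigma_sets ?R (ordered_boxes K)"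
  proof
    fix A assume "A \<in> sets (restrict_space ?L ?R)"
    then obtain B where "B \<in> sets ?L" "A = ?R \<inter> B" by (auto simp: sets_restrict_space)
    with measurable_sets[OF meas this(1)] show "A \<in> sigma_sets ?R (ordered_boxes K)"
      by (simp add: S Int_commute)
  qed
  show "sigma_sets ?R (ordered_boxes K) \<subseteq> sets (restrict_space ?L ?R)"
  proof -
    have "?R \<inter> space ?L \<in> sets ?L" using ordered_region_sets[OF K] by simp
    from sets_restrict_space_iff[OF this]
    have "ordered_boxes K \<subseteq> sets (restrict_space ?L ?R)"
      using ordered_boxes_sets[of K] sub by blast
    moreover have "space (restrict_space ?L ?R) = ?R"
      using sets.sets_into_space[OF ordered_region_sets[OF K]] by (auto simp: space_restrict_space)
    ultimately show ?thesis
      using sets.sigma_sets_subset[of "ordered_boxes K" "restrict_space ?L ?R"] by simp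
  qed
qed

section \<open>The integral of \<open>f_Lambda\<close> over an ordered box\<close>

lemma nn_integral_FTC_Ioc:
  fixes f F :: "real \<Rightarrow> real"
  assumes "f \<in> borel_measurable borel" "\<And>x. a \<le> x \<Longrightarrow> x \<le> b \<Longrightarrow> (F has_real_derivative f x) (at x)"
    "\<And>x. a \<le> x \<Longrightarrow> x \<le> b \<Longrightarrow> 0 \<le> f x" "a \<le> b"
  shows "(\<integral>\<^sup>+x. ennreal (f x * indicator {a<..b} x) \<partial>lborel) = ennreal (F b - F a)"
proof -
  have "(\<integral>\<^sup>+x. ennreal (f x * indicator {a<..b} x) \<partial>lborel) =
      (\<integral>\<^sup>+x. ennreal (f x) * indicator {a..b} x \<partial>lborel)"
    using AE_lborel_singleton[of a]
    by (intro nn_integral_cong_AE, eventually_elim) (auto split: split_indicator)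
  also have "\<dots> = ennreal (F b - F a)"
    using assms by (intro nn_integral_FTC_Icc) (auto intro: DERIV_subset)
  finally show ?thesis .
qed

text \<open>On the ordered region \<open>f_Lambda\<close> is a product of functions of single
  coordinates, \<open>2 * pi * lam * x\<close> each, with the exponential attached to the last. A
  box lies inside the region, so the integral splits into one-dimensional ones with antiderivatives
  \<open>lam * (pi * x^2)\<close> and \<open>- exp (- (lam * (pi * x^2)))\<close>.\<close>

lemma emeasure_density_f_Lambda_box:
  assumes K: "1 \<le> K" and a1: "0 \<le> a 1" and lam: "0 < lam"
    and ab: "\<And>i. i \<in> {1..K} \<Longrightarrow> a i < b i" and ba: "\<And>i. i \<in> {1..<K} \<Longrightarrow> b i \<le> a (Suc i)"
  shows "emeasure (density (Pi\<^sub>M {1..K} (\<lambda>_. lborel)) (\<lambda>r. ennreal (f_Lambda lam K r)))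
      (\<Pi>\<^sub>E i\<in>{1..K}. {a i<..b i}) =
    ennreal ((\<Prod>i\<in>{1..<K}. lam * (pi * (b i)\<^sup>2 - pi * (a i)\<^sup>2)) *
      (exp (- (lam * (pi * (a K)\<^sup>2))) - exp (- (lam * (pi * (b K)\<^sup>2)))))"
    (is "emeasure (density ?L _) ?B = _")
proof -
  interpret product_sigma_finite "\<lambda>_::nat. lborel :: real measure" ..
  have a_nonneg: "0 \<le> a i" if "i \<in> {1..K}" for i
    by (rule ordered_box_lower_nonneg[of a K b, OF a1 _ _ that]) (auto intro: ab ba)
  have B: "?B \<in> ordered_boxes K" using a1 ba by (intro ordered_boxesI)
  then have B_sets: "?B \<in> sets ?L" using ordered_boxes_sets by blast
  have B_region: "?B \<subseteq> ordered_region K" using B ordered_boxes_subset[OF K] by blast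
  define h where "h i x = 2 * pi * lam * x * (if i = K then exp (- (lam * (pi * x\<^sup>2))) else 1)"
    for i x
  have h_meas [measurable]: "h i \<in> borel_measurable borel" for i
    unfolding h_def by measurable
  have split: "{1..K} = insert K {1..<K}" using K by auto
  have f_eq: "f_Lambda lam K r = (\<Prod>i\<in>{1..K}. h i (r i))" if "r \<in> ordered_region K" for r
  proof -
    have "(\<Prod>i\<in>{1..K}. h i (r i)) =
        (\<Prod>i\<in>{1..K}. 2 * pi * lam) * (\<Prod>i\<in>{1..K}. r i) *
        (\<Prod>i\<in>{1..K}. if i = K then exp (- (lam * (pi * (r i)\<^sup>2))) else 1)"
      unfolding h_def prod.distrib by simp
    also have "(\<Prod>i\<in>{1..K}. if i = K then exp (- (lam * (pi * (r i)\<^sup>2))) else 1) =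
        exp (- (lam * (pi * (r K)\<^sup>2)))"
      using K by (simp add: prod.delta)
    finally show ?thesis using that by (simp add: f_Lambda_def algebra_simps)
  qed
  have "emeasure (density ?L (\<lambda>r. ennreal (f_Lambda lam K r))) ?B =
      (\<integral>\<^sup>+r. ennreal (f_Lambda lam K r) * indicator ?B r \<partial>?L)"
    using measurable_f_Lambda[OF K] by (intro emeasure_density B_sets) auto
  also have "\<dots> = (\<integral>\<^sup>+r. (\<Prod>i\<in>{1..K}. ennreal (h i (r i) * indicator {a i<..b i} (r i))) \<partial>?L)"
  proof (rule nn_integral_cong)
    fix r assume r: "r \<in> space ?L"
    have nonneg: "0 \<le> h i (r i) * indicator {a i<..b i} (r i)" if "i \<in> {1..K}" for i
      using a_nonneg[OF that] lam by (auto simp: h_def split: split_indicator)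
    show "ennreal (f_Lambda lam K r) * indicator ?B r =
        (\<Prod>i\<in>{1..K}. ennreal (h i (r i) * indicator {a i<..b i} (r i)))"
    proof (cases "r \<in> ?B")
      case True
      then have "indicator {a i<..b i} (r i) = (1::real)" if "i \<in> {1..K}" for i
        using that by (auto simp: PiE_iff)
      then have "(\<Prod>i\<in>{1..K}. ennreal (h i (r i) * indicator {a i<..b i} (r i))) =
          ennreal (\<Prod>i\<in>{1..K}. h i (r i))"
        using nonneg by (subst prod_ennreal) (auto intro!: arg_cong[of _ _ ennreal] prod.cong)
      then show ?thesis using True f_eq B_region by (simp add: subset_eq)
    next
      case False
      with r obtain i where "i \<in> {1..K}" "r i \<notin> {a i<..b i}"
        by (auto simp: space_PiM PiE_iff)
      then have "(\<Prod>i\<in>{1..K}. ennreal (h i (r i) * indicator {a i<..b i} (r i))) = 0"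
        by (intro prod_zero) (auto intro!: bexI[of _ i])
      with False show ?thesis by simp
    qed
  qed
  also have "\<dots> = (\<Prod>i\<in>{1..K}. \<integral>\<^sup>+x. ennreal (h i x * indicator {a i<..b i} x) \<partial>lborel)"
    by (intro product_nn_integral_prod) auto
  also have "\<dots> = (\<integral>\<^sup>+x. ennreal (h K x * indicator {a K<..b K} x) \<partial>lborel) *
      (\<Prod>i\<in>{1..<K}. \<integral>\<^sup>+x. ennreal (h i x * indicator {a i<..b i} x) \<partial>lborel)"
    unfolding split by simp
  also have "(\<integral>\<^sup>+x. ennreal (h K x * indicator {a K<..b K} x) \<partial>lborel) =
      ennreal (- exp (- (lam * (pi * (b K)\<^sup>2))) - (- exp (- (lam * (pi * (a K)\<^sup>2)))))"
    using a_nonneg[of K] ab[of K] lam K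
    by (intro nn_integral_FTC_Ioc) (auto simp: h_def intro!: derivative_eq_intros)
  also have "(\<Prod>i\<in>{1..<K}. \<integral>\<^sup>+x. ennreal (h i x * indicator {a i<..b i} x) \<partial>lborel) =
      (\<Prod>i\<in>{1..<K}. ennreal (lam * (pi * (b i)\<^sup>2) - lam * (pi * (a i)\<^sup>2)))"
  proof (rule prod.cong)
    fix i assume i: "i \<in> {1..<K}"
    then show "(\<integral>\<^sup>+x. ennreal (h i x * indicator {a i<..b i} x) \<partial>lborel) =
        ennreal (lam * (pi * (b i)\<^sup>2) - lam * (pi * (a i)\<^sup>2))"
      using a_nonneg[of i] ab[of i] lam
      by (intro nn_integral_FTC_Ioc) (auto simp: h_def intro!: derivative_eq_intros)
  qed simp
  also have "\<dots> = ennreal (\<Prod>i\<in>{1..<K}. lam * (pi * (b i)\<^sup>2 - pi * (a i)\<^sup>2))"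
  proof -
    have "0 \<le> lam * (pi * (b i)\<^sup>2) - lam * (pi * (a i)\<^sup>2)" if "i \<in> {1..<K}" for i
      using a_nonneg[of i] ab[of i] lam that by (auto intro!: mult_left_mono power_mono)
    then show ?thesis by (subst prod_ennreal) (auto simp: right_diff_distrib)
  qed
  also have "ennreal (- exp (- (lam * (pi * (b K)\<^sup>2))) - (- exp (- (lam * (pi * (a K)\<^sup>2))))) *
      ennreal (\<Prod>i\<in>{1..<K}. lam * (pi * (b i)\<^sup>2 - pi * (a i)\<^sup>2)) =
    ennreal ((\<Prod>i\<in>{1..<K}. lam * (pi * (b i)\<^sup>2 - pi * (a i)\<^sup>2)) *
      (exp (- (lam * (pi * (a K)\<^sup>2))) - exp (- (lam * (pi * (b K)\<^sup>2)))))"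
  proof (subst ennreal_mult'')
    show "0 \<le> exp (- (lam * (pi * (a K)\<^sup>2))) - exp (- (lam * (pi * (b K)\<^sup>2)))"
      using a_nonneg[of K] ab[of K] lam K by (auto intro!: mult_left_mono power_mono)
  qed (simp add: mult.commute)
  finally show ?thesis .
qed

section \<open>The joint density of the cluster distances\<close>

lemma measurable_nth_nearest_dists:
  "(\<lambda>S. \<lambda>i\<in>{1..K}. nth_nearest_dist i S) \<in>
    measurable (conf_space :: 'a::euclidean_space set measure) (Pi\<^sub>M {1..K} (\<lambda>_. lborel))"
  by (intro measurable_restrict) (auto intro: measurable_nth_nearest_dist)

text \<open>The law of the distances and the measure with density \<open>f_Lambda\<close> agree on
  boxes, hence on all measurable subsets of the ordered region. Outside it both vanish: the
  distances are almost surely strictly increasing and positive, and \<open>f_Lambda\<close> is 0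
  there.\<close>

lemma distributed_cluster_dists:
  fixes \<Phi> :: "'w \<Rightarrow> (real ^ 2) set"
  assumes "poisson_process P lam \<Phi>" and K: "1 \<le> K"
  shows "distributed P (Pi\<^sub>M {1..K} (\<lambda>_. lborel)) (cluster_dists K \<Phi>)
    (\<lambda>r. ennreal (f_Lambda lam K r))"
proof -
  interpret poisson_process P lam \<Phi> by fact
  let ?L = "Pi\<^sub>M {1..K} (\<lambda>_. lborel) :: (nat \<Rightarrow> real) measure"
  let ?X = "cluster_dists K \<Phi>" and ?R = "ordered_region K"
  define \<mu> where "\<mu> = distr P ?L ?X"
  define \<nu> where "\<nu> = density ?L (\<lambda>r. ennreal (f_Lambda lam K r))"
  have X: "?X \<in> measurable P ?L"
    unfolding cluster_dists_def
    using measurable_compose[OF measurable_Phi measurable_nth_nearest_dists] .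
  have f: "(\<lambda>r. ennreal (f_Lambda lam K r)) \<in> borel_measurable ?L"
    using measurable_f_Lambda[OF K] by simp
  note R = ordered_region_sets[OF K]
  have sets: "sets \<mu> = sets ?L" "sets \<nu> = sets ?L" by (simp_all add: \<mu>_def \<nu>_def)
  have vol_eq: "vol (cball (0::real^2) t) = pi * t\<^sup>2" if "0 \<le> t" for t
    using that by (simp add: content_cball unit_ball_vol_2)
  have box: "emeasure \<mu> B = emeasure \<nu> B" if "B \<in> ordered_boxes K" for B
  proof -
    from that obtain a b where B: "B = (\<Pi>\<^sub>E i\<in>{1..K}. {a i<..b i})" "0 \<le> a 1"
        "\<And>i. i \<in> {1..<K} \<Longrightarrow> b i \<le> a (Suc i)"
      unfolding ordered_boxes_def by blast
    show ?thesis
    proof (cases "\<forall>i\<in>{1..K}. a i < b i")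
      case False
      then have "B = {}" unfolding B(1) PiE_eq_empty_iff by auto
      then show ?thesis by simp
    next
      case True
      have nonneg: "0 \<le> a i" if "i \<in> {1..K}" for i
        by (rule ordered_box_lower_nonneg[of a K b, OF B(2) _ _ that]) (use True B(3) in auto)
      have b_nonneg: "0 \<le> b i" if "i \<in> {1..K}" for i
      proof -
        have "a i < b i" using True that by blast
        with nonneg[OF that] show ?thesis by linarith
      qed
      have "emeasure \<mu> B = emeasure P (?X -` B \<inter> space P)"
        unfolding \<mu>_def using ordered_boxes_sets that by (intro emeasure_distr X) auto
      also have "?X -` B \<inter> space P =
          {\<omega> \<in> space P. \<forall>i\<in>{1..K}. nth_nearest_dist i (\<Phi> \<omega>) \<in> {a i<..b i}}"
        by (auto simp: B(1) cluster_dists_def PiE_iff)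
      also have "emeasure P \<dots> = ennreal ((\<Prod>i\<in>{1..<K}. lam *
          (vol (cball (0::real^2) (b i)) - vol (cball (0::real^2) (a i)))) *
          (exp (- (lam * vol (cball (0::real^2) (a K)))) - exp (- (lam * vol (cball (0::real^2) (b K))))))"
        unfolding emeasure_eq_measure using True B by (subst prob_nth_nearest_dist_box[OF K]) auto
      also have "(\<Prod>i\<in>{1..<K}. lam *
          (vol (cball (0::real^2) (b i)) - vol (cball (0::real^2) (a i)))) =
          (\<Prod>i\<in>{1..<K}. lam * (pi * (b i)\<^sup>2 - pi * (a i)\<^sup>2))"
        by (intro prod.cong refl) (simp add: vol_eq nonneg b_nonneg)
      also have "ennreal (\<dots> * (exp (- (lam * vol (cball (0::real^2) (a K)))) -
          exp (- (lam * vol (cball (0::real^2) (b K)))))) = emeasure \<nu> B"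
        unfolding \<nu>_def B(1) using True B(2,3) lam_pos K
        by (subst emeasure_density_f_Lambda_box) (auto simp: vol_eq nonneg b_nonneg)
      finally show ?thesis .
    qed
  qed
  obtain A :: "nat \<Rightarrow> _" where A: "range A \<subseteq> ordered_boxes K" "(\<Union>i. A i) = ?R"
    using ordered_region_eq_Union_boxes[OF K] by blast
  have emeasure_restrict: "emeasure (restrict_space M ?R) B = emeasure M B"
    if "sets M = sets ?L" "B \<subseteq> ?R" for M B
    using that R sets.sets_into_space[OF R] sets_eq_imp_space_eq[OF that(1)]
    by (intro emeasure_restrict_space) (auto simp: Int_absorb2)
  have sets_restrict: "sets (restrict_space M ?R) = sigma_sets ?R (ordered_boxes K)"
    if "sets M = sets ?L" for M
    unfolding sets_restrict_ordered_region[OF K, symmetric]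
    using that by (rule sets_restrict_space_cong)
  have restrict_eq: "restrict_space \<mu> ?R = restrict_space \<nu> ?R"
  proof (rule measure_eqI_generator_eq[OF Int_stable_ordered_boxes ordered_boxes_subset[OF K]])
    fix B assume B: "B \<in> ordered_boxes K"
    then have "B \<subseteq> ?R" using ordered_boxes_subset[OF K] by blast
    then show "emeasure (restrict_space \<mu> ?R) B = emeasure (restrict_space \<nu> ?R) B"
      using box[OF B] by (simp add: emeasure_restrict sets)
  next
    fix i
    have "A i \<subseteq> ?R" using A(2) by blast
    then have "emeasure (restrict_space \<mu> ?R) (A i) = emeasure \<mu> (A i)"
      by (simp add: emeasure_restrict sets)
    moreover have "finite_measure \<mu>"
      unfolding \<mu>_def using prob_space_distr[OF X] by (rule prob_space.axioms)
    ultimately show "emeasure (restrict_space \<mu> ?R) (A i) \<noteq> \<infinity>"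
      using finite_measure.emeasure_finite[of \<mu>] by (simp add: top_unique)
  qed (use A sets_restrict sets in auto)
  have AE_R: "AE \<omega> in P. ?X \<omega> \<in> ?R"
    using AE_nth_nearest_dist_strict
    by eventually_elim (use K in \<open>auto simp: ordered_region_def cluster_dists_def\<close>)
  have "\<mu> = \<nu>"
  proof (rule measure_eqI)
    fix B assume "B \<in> sets \<mu>"
    then have B: "B \<in> sets ?L" by (simp add: sets)
    have "emeasure \<mu> B = emeasure P (?X -` B \<inter> space P)"
      unfolding \<mu>_def using B by (intro emeasure_distr X)
    also have "\<dots> = emeasure P (?X -` (B \<inter> ?R) \<inter> space P)"
    proof (rule emeasure_eq_AE)
      show "AE \<omega> in P. \<omega> \<in> ?X -` B \<inter> space P \<longleftrightarrow> \<omega> \<in> ?X -` (B \<inter> ?R) \<inter> space P"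
        using AE_R by eventually_elim auto
    qed (use B R in \<open>auto intro!: measurable_sets[OF X] simp del: vimage_Int\<close>)
    also have "\<dots> = emeasure \<mu> (B \<inter> ?R)"
      unfolding \<mu>_def using B R by (intro emeasure_distr[symmetric] X) auto
    also have "\<dots> = emeasure (restrict_space \<mu> ?R) (B \<inter> ?R)"
      by (simp add: emeasure_restrict sets)
    also have "\<dots> = emeasure \<nu> (B \<inter> ?R)"
      unfolding restrict_eq by (simp add: emeasure_restrict sets)
    also have "\<dots> = (\<integral>\<^sup>+r. ennreal (f_Lambda lam K r) * indicator (B \<inter> ?R) r \<partial>?L)"
      unfolding \<nu>_def using B R f by (intro emeasure_density) auto
    also have "\<dots> = (\<integral>\<^sup>+r. ennreal (f_Lambda lam K r) * indicator B r \<partial>?L)"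
      by (intro nn_integral_cong) (auto simp: f_Lambda_def split: split_indicator)
    also have "\<dots> = emeasure \<nu> B"
      unfolding \<nu>_def using B f by (intro emeasure_density[symmetric]) auto
    finally show "emeasure \<mu> B = emeasure \<nu> B" .
  qed (simp add: sets)
  then show ?thesis
    unfolding distributed_def using X f by (simp add: \<mu>_def \<nu>_def)
qed

section \<open>The association probability\<close>

lemma powr_uminus_less_iff:
  fixes \<alpha> :: real
  assumes "0 < \<alpha>" "0 < x" "0 < y" "0 < d"
  shows "d * x powr - \<alpha> < y \<longleftrightarrow> (d / y) powr (1 / \<alpha>) < x"
proof -
  have "d * x powr - \<alpha> < y \<longleftrightarrow> d / y < x powr \<alpha>"
    using assms by (simp add: powr_minus field_simps)
  also have "\<dots> \<longleftrightarrow> (d / y) powr (1 / \<alpha>) < (x powr \<alpha>) powr (1 / \<alpha>)"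
  proof
    show "d / y < x powr \<alpha> \<Longrightarrow> (d / y) powr (1 / \<alpha>) < (x powr \<alpha>) powr (1 / \<alpha>)"
      using assms by (intro powr_less_mono2) auto
    assume less: "(d / y) powr (1 / \<alpha>) < (x powr \<alpha>) powr (1 / \<alpha>)"
    show "d / y < x powr \<alpha>"
      by (rule powr_less_cancel2[OF _ _ _ less]) (use assms in auto)
  qed
  also have "(x powr \<alpha>) powr (1 / \<alpha>) = x"
    using assms by (simp add: powr_powr)
  finally show ?thesis .
qed

text \<open>The first conjunct certifies that the explicit \<open>f_Lambda\<close> is the joint
  density of the cluster distances, which gives the integral formula its meaning.\<close>

theorem proposition3:
  fixes P :: "'w measure"
    and \<Phi>m \<Phi>s :: "'w \<Rightarrow> (real ^ 2) set"
    and lam_m lam_s pm ps Bm Bs \<alpha> :: real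
    and Mm Ms \<Psi>m \<Psi>s K :: nat
  assumes "prob_space P"
    and "lam_m > 0" "lam_s > 0"
    and "homogeneous_ppp P lam_m \<Phi>m" "homogeneous_ppp P lam_s \<Phi>s"
    and "prob_space.indep_var P conf_space \<Phi>m conf_space \<Phi>s"
    and "pm > 0" "ps > 0" "Bm > 0" "Bs > 0" "\<alpha> > 2"
    and "Mm \<ge> \<Psi>m" "\<Psi>m \<ge> 1" "Ms \<ge> \<Psi>s" "\<Psi>s \<ge> 1"
    and "K \<ge> 1"
  shows "distributed P (Pi\<^sub>M {1..K} (\<lambda>_. lborel)) (cluster_dists K \<Phi>s)
           (\<lambda>r. ennreal (f_Lambda lam_s K r)) \<and>
         measure P (cluster_association_event P K \<alpha>
             Bm pm (spatial_gain Mm \<Psi>m) Bs ps (spatial_gain Ms \<Psi>s) \<Phi>m \<Phi>s) =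
         set_lebesgue_integral (Pi\<^sub>M {1..K} (\<lambda>_. lborel)) (ordered_region K)
           (\<lambda>r. exp (- lam_m * pi *
                  eta (ps / pm) (spatial_gain Ms \<Psi>s / spatial_gain Mm \<Psi>m) (Bs / Bm) \<alpha> K r
                    powr (2 / \<alpha>))
                * f_Lambda lam_s K r)"
proof -
  interpret M: poisson_process P lam_m \<Phi>m
    using assms by (simp add: poisson_process_def poisson_process_axioms_def)
  interpret S: poisson_process P lam_s \<Phi>s
    using assms by (simp add: poisson_process_def poisson_process_axioms_def)
  let ?L = "Pi\<^sub>M {1..K} (\<lambda>_. lborel) :: (nat \<Rightarrow> real) measure"
  let ?X = "cluster_dists K \<Phi>s" and ?R = "ordered_region K"
  have K: "1 \<le> K" by fact
  note R_sets [measurable] = ordered_region_sets[OF K]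
  have dist: "distributed P ?L ?X (\<lambda>r. ennreal (f_Lambda lam_s K r))"
    by (rule distributed_cluster_dists[OF S.poisson_process_axioms K])
  define Dm where "Dm = spatial_gain Mm \<Psi>m"
  define Ds where "Ds = spatial_gain Ms \<Psi>s"
  have D: "0 < Dm" "0 < Ds" using assms by (auto simp: Dm_def Ds_def spatial_gain_def)
  define Y where "Y \<omega> = infdist 0 (\<Phi>m \<omega>)" for \<omega>
  define G where "G r = (\<Sum>i=1..K. Bs * avg_received_power ps Ds \<alpha> (r i))" for r
  \<comment> \<open>The association condition as a set of pairs of a macro distance and a vector of
    cluster distances, so that its probability can be computed under the product law.\<close>
  define H where "H = {p \<in> space (borel \<Otimes>\<^sub>M ?L).
      Bm * avg_received_power pm Dm \<alpha> (fst p) < G (snd p)}"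
  define E where "E r = exp (- lam_m * pi *
      eta (ps / pm) (Ds / Dm) (Bs / Bm) \<alpha> K r powr (2 / \<alpha>))" for r
  have comp [measurable]: "(\<lambda>r. r i) \<in> borel_measurable ?L" if "i \<in> {1..K}" for i
    using measurable_component_singleton[OF that, of "\<lambda>_. lborel"] by simp
  have [measurable]: "G \<in> borel_measurable ?L" "E \<in> borel_measurable ?L"
    unfolding G_def E_def eta_def avg_received_power_def by measurable
  note measurable_f_Lambda[OF K, measurable]
  have Y_meas: "Y \<in> borel_measurable P"
    unfolding Y_def[abs_def] using measurable_compose[OF M.measurable_Phi measurable_infdist_conf_space] .
  have X_meas: "?X \<in> measurable P ?L" using dist by (simp add: distributed_def)
  have H_sets: "H \<in> sets (borel \<Otimes>\<^sub>M ?L)"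
    unfolding H_def avg_received_power_def by measurable
  \<comment> \<open>Independence is assumed for the configurations. Their product law is pushed
    forward along \<open>infdist 0\<close> and \<open>g\<close>, which act on separate
    factors.\<close>
  have joint: "distr P (borel \<Otimes>\<^sub>M ?L) (\<lambda>\<omega>. (Y \<omega>, ?X \<omega>)) = distr P borel Y \<Otimes>\<^sub>M distr P ?L ?X"
  proof -
    let ?C = "conf_space :: (real ^ 2) set measure"
    define g where "g S = (\<lambda>i\<in>{1..K}. nth_nearest_dist i S)" for S :: "(real ^ 2) set"
    have g: "g \<in> measurable ?C ?L"
      unfolding g_def[abs_def] by (rule measurable_nth_nearest_dists)
    then have g': "g \<in> measurable (distr P ?C \<Phi>s) ?L" by simp
    have X_eq: "?X = g \<circ> \<Phi>s" and Y_eq: "Y = infdist 0 \<circ> \<Phi>m"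
      by (simp_all add: fun_eq_iff cluster_dists_def g_def Y_def)
    \<comment> \<open>Mapping a product measure factor by factor asks for a sigma-finite second
      image.\<close>
    interpret DXg: prob_space "distr (distr P ?C \<Phi>s) ?L g"
      by (intro prob_space.prob_space_distr[OF M.prob_space_distr[OF S.measurable_Phi]] g')
    have "distr P borel Y \<Otimes>\<^sub>M distr P ?L ?X =
        distr (distr P ?C \<Phi>m) borel (infdist 0) \<Otimes>\<^sub>M distr (distr P ?C \<Phi>s) ?L g"
      unfolding X_eq Y_eq distr_distr[OF g S.measurable_Phi]
        distr_distr[OF measurable_infdist_conf_space M.measurable_Phi] ..
    also have "\<dots> = distr (distr P ?C \<Phi>m \<Otimes>\<^sub>M distr P ?C \<Phi>s) (borel \<Otimes>\<^sub>M ?L)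
        (\<lambda>(S, T). (infdist 0 S, g T))"
      using DXg.sigma_finite_measure_axioms
      by (intro pair_measure_distr g') (simp_all add: measurable_infdist_conf_space)
    also have "distr P ?C \<Phi>m \<Otimes>\<^sub>M distr P ?C \<Phi>s = distr P (?C \<Otimes>\<^sub>M ?C) (\<lambda>\<omega>. (\<Phi>m \<omega>, \<Phi>s \<omega>))"
      using assms(6) by (simp add: M.indep_var_distribution_eq)
    also have "distr \<dots> (borel \<Otimes>\<^sub>M ?L) (\<lambda>(S, T). (infdist 0 S, g T)) =
        distr P (borel \<Otimes>\<^sub>M ?L) ((\<lambda>(S, T). (infdist 0 S, g T)) \<circ> (\<lambda>\<omega>. (\<Phi>m \<omega>, \<Phi>s \<omega>)))"
      unfolding split_beta'
      by (intro distr_distr measurable_Pair M.measurable_Phi S.measurable_Phi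
          measurable_compose[OF measurable_fst measurable_infdist_conf_space]
          measurable_compose[OF measurable_snd g])
    finally show ?thesis by (simp add: X_eq Y_eq comp_def)
  qed
  interpret DY: prob_space "distr P borel Y" by (rule M.prob_space_distr[OF Y_meas])
  interpret DX: prob_space "distr P ?L ?X" by (rule M.prob_space_distr[OF X_meas])
  interpret DYX: pair_sigma_finite "distr P borel Y" "distr P ?L ?X" ..
  have H_sets': "H \<in> sets (distr P borel Y \<Otimes>\<^sub>M distr P ?L ?X)"
    unfolding joint[symmetric] using H_sets by simp
  \<comment> \<open>For fixed cluster distances the section of \<open>H\<close> is almost surely the
    event that the closed disc of radius \<open>e powr (1 / \<alpha>)\<close> holds no macro
    station; its area is \<open>pi * e powr (2 / \<alpha>)\<close>.\<close>
  have slice: "emeasure (distr P borel Y) ((\<lambda>y. (y, r)) -` H) = ennreal (E r)" if r: "r \<in> ?R" for r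
  proof -
    have pos: "0 < r 1" using r by (simp add: ordered_region_def)
    have r_space: "r \<in> space ?L" using sets.sets_into_space[OF R_sets] r by blast
    define \<sigma> where "\<sigma> = (\<Sum>i=1..K. r i powr - \<alpha>)"
    have \<sigma>: "0 < \<sigma>"
      unfolding \<sigma>_def using pos K by (intro sum_pos2[of _ 1]) auto
    define e where "e = eta (ps / pm) (Ds / Dm) (Bs / Bm) \<alpha> K r"
    have G_eq: "G r = Bs * ps * Ds * \<sigma>"
      by (simp add: G_def avg_received_power_def \<sigma>_def sum_distrib_left mult.assoc)
    \<comment> \<open>In this form \<open>e powr (1 / \<alpha>)\<close> is visibly the distance at
      which the biased macro power equals the biased cluster power \<open>G r\<close>.\<close>
    have e_eq: "e = Bm * pm * Dm / G r"
      unfolding e_def eta_def G_eq \<sigma>_def[symmetric] using D assms \<sigma> by (simp add: field_simps)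
    have G_pos: "0 < G r" unfolding G_eq using D assms \<sigma> by simp
    have "emeasure (distr P borel Y) ((\<lambda>y. (y, r)) -` H) =
        emeasure P (Y -` ((\<lambda>y. (y, r)) -` H) \<inter> space P)"
      using sets_Pair2[OF H_sets] by (intro emeasure_distr Y_meas) auto
    also have "\<dots> = emeasure P {\<omega> \<in> space P. e powr (1 / \<alpha>) < Y \<omega>}"
    proof (rule emeasure_eq_AE)
      show "AE \<omega> in P. \<omega> \<in> Y -` ((\<lambda>y. (y, r)) -` H) \<inter> space P \<longleftrightarrow>
          \<omega> \<in> {\<omega> \<in> space P. e powr (1 / \<alpha>) < Y \<omega>}"
        using M.AE_infdist_pos
      proof eventually_elim
        case (elim \<omega>)
        have "Bm * avg_received_power pm Dm \<alpha> (Y \<omega>) < G r \<longleftrightarrow> e powr (1 / \<alpha>) < Y \<omega>"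
          using powr_uminus_less_iff[of \<alpha> "Y \<omega>" "G r" "Bm * pm * Dm"] elim D assms G_pos
          by (simp add: avg_received_power_def e_eq Y_def mult.assoc)
        then show ?case using r_space by (simp add: H_def space_pair_measure conj_commute)
      qed
      show "Y -` ((\<lambda>y. (y, r)) -` H) \<inter> space P \<in> sets P"
        using sets_Pair2[OF H_sets] by (intro measurable_sets[OF Y_meas]) auto
      show "{\<omega> \<in> space P. e powr (1 / \<alpha>) < Y \<omega>} \<in> sets P"
        using Y_meas by measurable
    qed
    also have "\<dots> = ennreal (exp (- (lam_m * (pi * (e powr (1 / \<alpha>))\<^sup>2))))"
      unfolding Y_def M.emeasure_eq_measure M.prob_less_infdist
      by (simp add: content_cball unit_ball_vol_2)
    also have "(e powr (1 / \<alpha>))\<^sup>2 = e powr (2 / \<alpha>)"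
      by (simp add: power2_eq_square flip: powr_add)
    finally show ?thesis by (simp add: E_def e_def)
  qed
  let ?A = "cluster_association_event P K \<alpha> Bm pm Dm Bs ps Ds \<Phi>m \<Phi>s"
  have A_eq: "?A = (\<lambda>\<omega>. (Y \<omega>, ?X \<omega>)) -` H \<inter> space P"
    using measurable_space[OF X_meas]
    by (auto simp: cluster_association_event_def H_def G_def Y_def space_pair_measure)
  have "emeasure P ?A = emeasure (distr P (borel \<Otimes>\<^sub>M ?L) (\<lambda>\<omega>. (Y \<omega>, ?X \<omega>))) H"
    unfolding A_eq by (intro emeasure_distr[symmetric] H_sets measurable_Pair Y_meas X_meas)
  \<comment> \<open>Fubini with the cluster distances as the outer variable, which amounts to
    conditioning on them.\<close>
  also have "\<dots> = (\<integral>\<^sup>+r. emeasure (distr P borel Y) ((\<lambda>y. (y, r)) -` H) \<partial>distr P ?L ?X)"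
    unfolding joint by (intro DYX.emeasure_pair_measure_alt2 H_sets')
  also have "distr P ?L ?X = density ?L (\<lambda>r. ennreal (f_Lambda lam_s K r))"
    using dist by (simp add: distributed_def)
  also have "(\<integral>\<^sup>+r. emeasure (distr P borel Y) ((\<lambda>y. (y, r)) -` H) \<partial>\<dots>) =
      (\<integral>\<^sup>+r. ennreal (f_Lambda lam_s K r) * emeasure (distr P borel Y) ((\<lambda>y. (y, r)) -` H) \<partial>?L)"
  proof (rule nn_integral_density)
    show "(\<lambda>r. emeasure (distr P borel Y) ((\<lambda>y. (y, r)) -` H)) \<in> borel_measurable ?L"
      using DYX.measurable_emeasure_Pair2[OF H_sets'] by simp
  qed (use measurable_f_Lambda[OF K] in simp)
  also have "\<dots> = (\<integral>\<^sup>+r. ennreal (indicator ?R r *\<^sub>R (E r * f_Lambda lam_s K r)) \<partial>?L)"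
  proof (rule nn_integral_cong)
    fix r
    show "ennreal (f_Lambda lam_s K r) * emeasure (distr P borel Y) ((\<lambda>y. (y, r)) -` H) =
        ennreal (indicator ?R r *\<^sub>R (E r * f_Lambda lam_s K r))"
    \<comment> \<open>The void probability of the section is known only on the ordered region;
      elsewhere \<open>f_Lambda\<close> makes both sides 0.\<close>
    proof (cases "r \<in> ?R")
      case True
      then show ?thesis by (simp add: slice E_def ennreal_mult'' mult.commute)
    qed (simp add: f_Lambda_def)
  qed
  finally have "emeasure P ?A =
      (\<integral>\<^sup>+r. ennreal (indicator ?R r *\<^sub>R (E r * f_Lambda lam_s K r)) \<partial>?L)" .
  moreover have "set_lebesgue_integral ?L ?R (\<lambda>r. E r * f_Lambda lam_s K r) =
      enn2real (\<integral>\<^sup>+r. ennreal (indicator ?R r *\<^sub>R (E r * f_Lambda lam_s K r)) \<partial>?L)"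
    unfolding set_lebesgue_integral_def
  proof (rule integral_eq_nn_integral)
    have "0 \<le> f_Lambda lam_s K r" for r
    proof (cases "r \<in> ?R")
      case True
      have "0 \<le> (\<Prod>i=1..K. r i)"
        by (intro prod_nonneg less_imp_le ordered_region_pos[OF True])
      then show ?thesis using True assms by (simp add: f_Lambda_def)
    qed (simp add: f_Lambda_def)
    then show "AE r in ?L. 0 \<le> indicator ?R r *\<^sub>R (E r * f_Lambda lam_s K r)"
      by (simp add: E_def)
  qed measurable
  ultimately have "measure P ?A = set_lebesgue_integral ?L ?R (\<lambda>r. E r * f_Lambda lam_s K r)"
    by (simp add: measure_def)
  with dist show ?thesis by (simp add: E_def Dm_def Ds_def)
qed

end
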